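(* Assume $c_R\ge c_S$. Let the aggregation function $t$ (with $m$ arguments) be strictly monotone in each argument. Let $\mathbf{D}$ be the class of all databases (with $m$ sorted lists) that satisfy the distinctness property. Let $\mathbf{A}$ be the class of all algorithms that correctly find the top $k$ objects for $t$ for every database in $\mathbf{D}$. Then the algorithm CA is instance optimal over $\mathbf{A}$ and $\mathbf{D}$, with optimality ratio independent of $c_R/c_S$ (that is, the optimality ratio can be chosen as a constant that stays the same when $c_R$ and $c_S$ vary).
   Context: Setting: fix positive integers $m$ and $k$ (treated as constants). A database consists of a finite set of $N\ge k$ objects; each object $R$ has $m$ grades (fields) $x_1,\dots,x_m\in[0,1]$. It is presented as $m$ sorted lists $L_1,\dots,L_m$ of length $N$; list $L_i$ contains one entry $(R,x_i)$ for each object $R$, in descending order of $x_i$. A database satisfies the distinctness property if for each $i$ no two objects have the same grade in list $L_i$. An aggregation function is a fixed function $t:[0,1]^m\to[0,\infty)$; the overall grade of $R$ is $t(R)=t(x_1,\dots,x_m)$. $t$ is strictly monotone in each argument if whenever one argument is strictly increased and the remaining arguments are held fixed, the value of $t$ strictly increases. Finding the top $k$ objects means outputting $k$ objects with the highest overall grades (ties broken arbitrarily), without necessarily giving their grades. Access and cost: an algorithm obtains information about the database only by sorted access (reading the next entry of some list, proceeding sequentially from the top) and random access (requesting the grade of a given object in a given list, obtained in one step; the object may be one not previously seen). Internal computation is free. With $s$ sorted and $r$ random accesses the middleware cost is $s c_S+r c_R$, where $c_S,c_R>0$; $cost(\mathcal A,\mathcal D)$ is the middleware cost of algorithm $\mathcal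 A$ on database $\mathcal D$. Instance optimality: algorithm $\mathcal B$ is instance optimal over $\mathbf A$ and $\mathbf D$ with optimality ratio $c$ if $\mathcal B\in\mathbf A$ and there is a constant $c'$ such that $cost(\mathcal B,\mathcal D)\le c\cdot cost(\mathcal A,\mathcal D)+c'$ for every $\mathcal A\in\mathbf A$ and $\mathcal D\in\mathbf D$. (The additive constant $c'$ may depend on $c_S,c_R$.) Bounds: for an object $R$ with set $S\subseteq\{1,\dots,m\}$ of known fields, $W_S(R)$ is the value of $t$ obtained by using the known values for the fields in $S$ and $0$ for every other field; $B_S(R)$ is the value of $t$ obtained by using the known values for the fields in $S$ and $\underline{x}_i$ for every field $i\notin S$, where $\underline{x}_i$ (the bottom value) is the last value obtained under sorted access in $L_i$. Algorithm CA, with $h=\lfloor c_R/c_S\rfloor$: (1) Do sorted access in parallel to each of the lists. At each depth $d$ (when $d$ entries have been read in each list): maintain the bottom values $\underline{x}_i^{(d)}$; for every object $R$ with discovered fields $S=S^{(d)}(R)$ (discovered by sorted or random access) let $W^{(d)}(R)=W_S(R)$ and $B^{(d)}(R)=B_S(R)$ (for unseen $R$, $S=\emptyset$). Let $T_k^{(d)}$ contain the $k$ objects seen so far with the largest $W^{(d)}$ values, ties being broken in favor of the larger $B^{(d)}$ value (and arbitrarily if these also tie). Let $M_k^{(d)}$ be the $k$th largest $W^{(d)}$ value in $T_k^{(d)}$. (2) Call $R$ viable if $B^{(d)}(R)>M_k^{(d)}$ (convention: while fewer than $k$ objects have been seen, every object counts as viable). Every time the depth increases by $h$: pick the viable object that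 has been seen, for which not all fields are known, and whose $B^{(d)}$ value is as big as possible (ties broken arbitrarily), and perform random accesses for all of its (at most $m-1$) missing fields, updating the bounds accordingly; if there is no such object, do no random access on this step. (3) Halt when (a) at least $k$ distinct objects have been seen and (b) $B^{(d)}(R)\le M_k^{(d)}$ for all objects $R\notin T_k^{(d)}$. Return the objects in $T_k^{(d)}$. *)

theory Defs
  imports "HOL-Analysis.Analysis"
begin

section \<open>Databases\<close>

text \<open>The \<open>m\<close> lists are indexed by a finite type \<open>'m\<close>, and objects are named by elements of \<open>'a\<close>.\<close>

type_synonym ('a, 'm) database = "'m \<Rightarrow> ('a \<times> real) list"

definition objs :: "('a, 'm) database \<Rightarrow> 'a set" where
  "objs D = (\<Union>i. fst ` set (D i))"

definition is_database :: "nat \<Rightarrow> ('a, 'm) database \<Rightarrow> bool" where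
  "is_database k D \<longleftrightarrow> k \<le> card (objs D) \<and>
     (\<forall>i. distinct (map fst (D i)) \<and> fst ` set (D i) = objs D \<and>
          snd ` set (D i) \<subseteq> {0..1} \<and> sorted_wrt (\<ge>) (map snd (D i)))"

definition distinctness :: "('a, 'm) database \<Rightarrow> bool" where
  "distinctness D \<longleftrightarrow> (\<forall>i. distinct (map snd (D i)))"

definition grade :: "('a, 'm) database \<Rightarrow> 'a \<Rightarrow> 'm \<Rightarrow> real" where
  "grade D R i = the (map_of (D i) R)"

definition overall :: "(real ^ 'm \<Rightarrow> real) \<Rightarrow> ('a, 'm::finite) database \<Rightarrow> 'a \<Rightarrow> real" where
  "overall t D R = t (\<chi> i. grade D R i)"

definition is_top_k :: "nat \<Rightarrow> (real ^ 'm \<Rightarrow> real) \<Rightarrow> ('a, 'm::finite) database \<Rightarrow> 'a set \<Rightarrow> bool" where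
  "is_top_k k t D Y \<longleftrightarrow> Y \<subseteq> objs D \<and> card Y = k \<and>
     (\<forall>R\<in>Y. \<forall>R'\<in>objs D - Y. overall t D R' \<le> overall t D R)"


section \<open>Aggregation functions\<close>

definition unit_cube :: "(real ^ 'm) set" where
  "unit_cube = {x. \<forall>i. x $ i \<in> {0..1}}"

definition aggregation_function :: "(real ^ 'm \<Rightarrow> real) \<Rightarrow> bool" where
  "aggregation_function t \<longleftrightarrow> (\<forall>x\<in>unit_cube. 0 \<le> t x)"

definition strictly_monotone_each :: "(real ^ 'm \<Rightarrow> real) \<Rightarrow> bool" where
  "strictly_monotone_each t \<longleftrightarrow>
     (\<forall>x\<in>unit_cube. \<forall>y\<in>unit_cube. \<forall>i.
        x $ i < y $ i \<and> (\<forall>j. j \<noteq> i \<longrightarrow> x $ j = y $ j) \<longrightarrow> t x < t y)"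


section \<open>Algorithms and their cost\<close>

datatype ('a, 'm) action = Sorted 'm | Random 'a 'm | Halt "'a set"

datatype ('a, 'm) event =
    is_sorted: SortedRes 'm "('a \<times> real) option"
  | is_random: RandomRes 'a 'm "real option"

type_synonym ('a, 'm) history = "('a, 'm) event list"

text \<open>
  An algorithm is an adaptive deterministic strategy. The names of the objects are given (an
  algorithm may request the grade of an object that it has not yet seen), but everything else it
  learns about the database comes from the answers recorded in the history (oldest first).
  A strategy that is given only the history is the special case of one that ignores its first
  argument.
\<close>

type_synonym ('a, 'm) algorithm = "'a set \<Rightarrow> ('a, 'm) history \<Rightarrow> ('a, 'm) action"

definition sorted_count :: "('a, 'm) history \<Rightarrow> 'm \<Rightarrow> nat" where
  "sorted_count hs i = length (filter (\<lambda>e. \<exists>r. e = SortedRes i r) hs)"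

text \<open>
  Sorted access past the end of a list and random access to an object that is not in the database
  yield \<open>None\<close>, and are charged like any other access.
\<close>

definition sorted_answer :: "('a, 'm) database \<Rightarrow> ('a, 'm) history \<Rightarrow> 'm \<Rightarrow> ('a \<times> real) option" where
  "sorted_answer D hs i =
     (if sorted_count hs i < length (D i) then Some (D i ! sorted_count hs i) else None)"

definition step :: "('a, 'm) algorithm \<Rightarrow> ('a, 'm) database \<Rightarrow> ('a, 'm) history \<Rightarrow> ('a, 'm) history" where
  "step A D hs = (case A (objs D) hs of
       Sorted i \<Rightarrow> hs @ [SortedRes i (sorted_answer D hs i)]
     | Random R i \<Rightarrow> hs @ [RandomRes R i (map_of (D i) R)]
     | Halt Y \<Rightarrow> hs)"

definition run :: "('a, 'm) algorithm \<Rightarrow> ('a, 'm) database \<Rightarrow> nat \<Rightarrow> ('a, 'm) history" where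
  "run A D n = (step A D ^^ n) []"

definition outputs :: "('a, 'm) algorithm \<Rightarrow> ('a, 'm) database \<Rightarrow> 'a set \<Rightarrow> bool" where
  "outputs A D Y \<longleftrightarrow> (\<exists>n. A (objs D) (run A D n) = Halt Y)"

text \<open>The history at the moment of halting; only meaningful if \<open>A\<close> halts on \<open>D\<close>.\<close>

definition final_history :: "('a, 'm) algorithm \<Rightarrow> ('a, 'm) database \<Rightarrow> ('a, 'm) history" where
  "final_history A D = run A D (LEAST n. \<exists>Y. A (objs D) (run A D n) = Halt Y)"

definition cost :: "real \<Rightarrow> real \<Rightarrow> ('a, 'm) algorithm \<Rightarrow> ('a, 'm) database \<Rightarrow> real" where
  "cost cS cR A D =
     real (length (filter is_sorted (final_history A D))) * cS +
     real (length (filter is_random (final_history A D))) * cR"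

definition finds_top_k ::
    "nat \<Rightarrow> (real ^ 'm \<Rightarrow> real) \<Rightarrow> ('a, 'm::finite) database set \<Rightarrow> ('a, 'm) algorithm \<Rightarrow> bool" where
  "finds_top_k k t DD A \<longleftrightarrow> (\<forall>D\<in>DD. \<exists>Y. outputs A D Y \<and> is_top_k k t D Y)"

definition instance_optimal ::
    "real \<Rightarrow> real \<Rightarrow> ('a, 'm) algorithm set \<Rightarrow> ('a, 'm) database set \<Rightarrow> real \<Rightarrow>
     ('a, 'm) algorithm \<Rightarrow> bool" where
  "instance_optimal cS cR AA DD c B \<longleftrightarrow> B \<in> AA \<and>
     (\<exists>c'. \<forall>A\<in>AA. \<forall>D\<in>DD. cost cS cR B D \<le> c * cost cS cR A D + c')"


section \<open>Knowledge contained in a history\<close>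

fun learned :: "('a, 'm) event \<Rightarrow> (('a \<times> 'm) \<times> real) list" where
  "learned (SortedRes i (Some (R, x))) = [((R, i), x)]"
| "learned (RandomRes R i (Some x)) = [((R, i), x)]"
| "learned _ = []"

definition field :: "('a, 'm) history \<Rightarrow> 'a \<Rightarrow> 'm \<Rightarrow> real option" where
  "field hs R i = map_of (concat (map learned hs)) (R, i)"

definition seen :: "('a, 'm) history \<Rightarrow> 'a set" where
  "seen hs = {R. \<exists>i. field hs R i \<noteq> None}"

definition incomplete :: "('a, 'm) history \<Rightarrow> 'a \<Rightarrow> bool" where
  "incomplete hs R \<longleftrightarrow> (\<exists>i. field hs R i = None)"

text \<open>The default value 1, before any sorted access to the list, is never used by CA.\<close>

definition bottom :: "('a, 'm) history \<Rightarrow> 'm \<Rightarrow> real" where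
  "bottom hs i = last (1 # [x. SortedRes j (Some (R, x)) \<leftarrow> hs, j = i])"

definition W_bound :: "(real ^ 'm \<Rightarrow> real) \<Rightarrow> ('a, 'm::finite) history \<Rightarrow> 'a \<Rightarrow> real" where
  "W_bound t hs R = t (\<chi> i. case field hs R i of Some x \<Rightarrow> x | None \<Rightarrow> 0)"

definition B_bound :: "(real ^ 'm \<Rightarrow> real) \<Rightarrow> ('a, 'm::finite) history \<Rightarrow> 'a \<Rightarrow> real" where
  "B_bound t hs R = t (\<chi> i. case field hs R i of Some x \<Rightarrow> x | None \<Rightarrow> bottom hs i)"


section \<open>Algorithm CA\<close>

text \<open>
  \<open>Tk k t hs T\<close>: \<open>T\<close> is an admissible choice of \<open>T\<^sub>k\<close>. Since \<open>T\<close> has exactly \<open>k\<close> elements,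
  the \<open>k\<close>th largest \<open>W\<close> value in it is the least one, and it is the same for every admissible \<open>T\<close>.
\<close>

definition Tk :: "nat \<Rightarrow> (real ^ 'm \<Rightarrow> real) \<Rightarrow> ('a, 'm::finite) history \<Rightarrow> 'a set \<Rightarrow> bool" where
  "Tk k t hs T \<longleftrightarrow> T \<subseteq> seen hs \<and> card T = k \<and>
     (\<forall>R\<in>T. \<forall>R'\<in>seen hs - T.
        W_bound t hs R' < W_bound t hs R \<or> (W_bound t hs R' = W_bound t hs R \<and> B_bound t hs R' \<le> B_bound t hs R))"

definition Mk :: "(real ^ 'm \<Rightarrow> real) \<Rightarrow> ('a, 'm::finite) history \<Rightarrow> 'a set \<Rightarrow> real" where
  "Mk t hs T = Min (W_bound t hs ` T)"

definition viable :: "nat \<Rightarrow> (real ^ 'm \<Rightarrow> real) \<Rightarrow> ('a, 'm::finite) history \<Rightarrow> 'a \<Rightarrow> bool" where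
  "viable k t hs R \<longleftrightarrow> card (seen hs) < k \<or> (\<exists>T. Tk k t hs T \<and> Mk t hs T < B_bound t hs R)"

definition depth :: "('a, 'm::finite) history \<Rightarrow> nat" where
  "depth hs = Min (range (sorted_count hs))"

definition candidates :: "nat \<Rightarrow> (real ^ 'm \<Rightarrow> real) \<Rightarrow> ('a, 'm::finite) history \<Rightarrow> 'a set" where
  "candidates k t hs = {R \<in> seen hs. viable k t hs R \<and> incomplete hs R}"

text \<open>
  Objects whose missing fields may be requested next, when the current depth is complete. If the
  last access was sorted, the random accesses for this depth have not begun; if it was a random
  access to \<open>R\<close>, then \<open>R\<close> is the object picked at this depth, and its remaining missing fields
  are still to be requested.
\<close>

definition targets ::
    "nat \<Rightarrow> nat \<Rightarrow> (real ^ 'm \<Rightarrow> real) \<Rightarrow> ('a, 'm::finite) history \<Rightarrow> 'a set" where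
  "targets h k t hs = (case last hs of
       SortedRes _ _ \<Rightarrow>
         (if h dvd depth hs
          then {R \<in> candidates k t hs. \<forall>R'\<in>candidates k t hs. B_bound t hs R' \<le> B_bound t hs R} else {})
     | RandomRes R _ _ \<Rightarrow> {R'. R' = R \<and> incomplete hs R})"

text \<open>
  The set of actions CA may take next when \<open>Obj\<close> is the set of objects; several are possible
  because ties are broken arbitrarily, because the order of the sorted accesses within a parallel
  round is immaterial, and because the missing fields of the picked object may be requested in
  any order. At every depth, the sorted accesses are followed by the random accesses (if the depth
  is a multiple of \<open>h\<close>), and then by the test for halting. The set \<open>Obj\<close> is used only in that test.
\<close>

definition CA_actions ::
    "nat \<Rightarrow> nat \<Rightarrow> (real ^ 'm \<Rightarrow> real) \<Rightarrow> 'a set \<Rightarrow> ('a, 'm::finite) history \<Rightarrow>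
     ('a, 'm) action set" where
  "CA_actions h k t Obj hs =
     (if depth hs = 0 \<or> (\<exists>i. sorted_count hs i \<noteq> depth hs)
      then {Sorted i |i. sorted_count hs i = depth hs}
      else if targets h k t hs \<noteq> {}
      then {Random R i |R i. R \<in> targets h k t hs \<and> field hs R i = None}
      else if card (seen hs) < k
      then range Sorted
      else {a. \<exists>T. Tk k t hs T \<and>
                 (if \<forall>R\<in>Obj - T. B_bound t hs R \<le> Mk t hs T then a = Halt T else a \<in> range Sorted)})"

definition is_CA ::
    "real \<Rightarrow> real \<Rightarrow> nat \<Rightarrow> (real ^ 'm \<Rightarrow> real) \<Rightarrow> ('a, 'm::finite) algorithm \<Rightarrow> bool" where
  "is_CA cS cR k t A \<longleftrightarrow>
     (\<forall>Obj hs. A Obj hs \<in> CA_actions (nat \<lfloor>cR / cS\<rfloor>) k t Obj hs)"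

text \<open>The rules of CA never get stuck, so implementations of CA exist.\<close>

lemma finite_seen: "finite (seen hs)"
proof (rule finite_subset)
  show "seen hs \<subseteq> (\<lambda>p. fst (fst p)) ` set (concat (map learned hs))"
  proof
    fix R assume "R \<in> seen hs"
    then obtain i x where "map_of (concat (map learned hs)) (R, i) = Some x"
      unfolding seen_def field_def by blast
    then have "((R, i), x) \<in> set (concat (map learned hs))" by (rule map_of_SomeD)
    then show "R \<in> (\<lambda>p. fst (fst p)) ` set (concat (map learned hs))"
      by (metis fst_conv imageI)
  qed
qed simp

lemma ex_arg_max_real:
  fixes f :: "'a \<Rightarrow> real"
  assumes "finite S" "S \<noteq> {}"
  shows "\<exists>x\<in>S. \<forall>y\<in>S. f y \<le> f x"
proof -
  have "Max (f ` S) \<in> f ` S" using assms by (intro Max_in) auto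
  then obtain x where "x \<in> S" "f x = Max (f ` S)" by auto
  then show ?thesis using assms by (intro bexI[of _ x]) auto
qed

lemma ex_Tk:
  assumes "k \<le> card (seen hs)"
  shows "\<exists>T. Tk k t hs T"
  using assms
proof (induction k)
  case 0
  show ?case by (rule exI[of _ "{}"]) (simp add: Tk_def)
next
  case (Suc k)
  then obtain T where T: "Tk k t hs T" by auto
  let ?S = "seen hs - T"
  have fT: "finite T" using T finite_seen finite_subset unfolding Tk_def by blast
  have "?S \<noteq> {}"
  proof
    assume "?S = {}"
    then have "seen hs \<subseteq> T" by auto
    then have "card (seen hs) \<le> card T" using fT card_mono by blast
    then show False using T Suc.prems unfolding Tk_def by auto
  qed
  then obtain x where x: "x \<in> ?S" "\<forall>y\<in>?S. W_bound t hs y \<le> W_bound t hs x"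
    using ex_arg_max_real[OF finite_Diff[OF finite_seen] \<open>?S \<noteq> {}\<close>] by metis
  let ?E = "{y \<in> ?S. W_bound t hs y = W_bound t hs x}"
  have "finite ?E" "?E \<noteq> {}" using finite_seen[of hs] x(1) by auto
  from ex_arg_max_real[OF this, of "B_bound t hs"]
  obtain z where z: "z \<in> ?E" "\<forall>y\<in>?E. B_bound t hs y \<le> B_bound t hs z" by (rule bexE)
  have "Tk (Suc k) t hs (insert z T)"
    unfolding Tk_def
  proof (intro conjI ballI)
    show "insert z T \<subseteq> seen hs" using T z unfolding Tk_def by auto
    show "card (insert z T) = Suc k" using T z fT unfolding Tk_def by auto
    fix R R' assume R: "R \<in> insert z T" "R' \<in> seen hs - insert z T"
    show "W_bound t hs R' < W_bound t hs R \<or> (W_bound t hs R' = W_bound t hs R \<and> B_bound t hs R' \<le> B_bound t hs R)"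
    proof (cases "R \<in> T")
      case True
      then show ?thesis using T R unfolding Tk_def by auto
    next
      case False
      then have "R = z" using R by auto
      moreover have "W_bound t hs R' \<le> W_bound t hs x" using x(2) R by auto
      ultimately show ?thesis using z R by fastforce
    qed
  qed
  then show ?case by blast
qed

lemma CA_actions_nonempty: "CA_actions h k t Obj hs \<noteq> {}"
proof -
  have "depth hs \<in> range (sorted_count hs)"
    unfolding depth_def by (rule Min_in) auto
  then obtain i0 where i0: "sorted_count hs i0 = depth hs" by auto
  consider (round) "depth hs = 0 \<or> (\<exists>i. sorted_count hs i \<noteq> depth hs)"
    | (random) "\<not> (depth hs = 0 \<or> (\<exists>i. sorted_count hs i \<noteq> depth hs))" "targets h k t hs \<noteq> {}"
    | (few) "\<not> (depth hs = 0 \<or> (\<exists>i. sorted_count hs i \<noteq> depth hs))" "targets h k t hs = {}"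
        "card (seen hs) < k"
    | (test) "\<not> (depth hs = 0 \<or> (\<exists>i. sorted_count hs i \<noteq> depth hs))" "targets h k t hs = {}"
        "\<not> card (seen hs) < k"
    by argo
  then show ?thesis
  proof cases
    case round
    then have "Sorted i0 \<in> CA_actions h k t Obj hs" using i0 by (simp add: CA_actions_def)
    then show ?thesis by blast
  next
    case random
    then obtain R where R: "R \<in> targets h k t hs" by blast
    then have "incomplete hs R"
      unfolding targets_def candidates_def by (simp split: event.splits if_splits)
    then obtain i where "field hs R i = None" unfolding incomplete_def by blast
    with random R have "Random R i \<in> CA_actions h k t Obj hs"
      unfolding CA_actions_def by (simp only: if_False if_True not_False_eq_True) blast
    then show ?thesis by blast
  next
    case few
    then have "Sorted i0 \<in> CA_actions h k t Obj hs" unfolding CA_actions_def by simp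
    then show ?thesis by blast
  next
    case test
    then obtain T where T: "Tk k t hs T" using ex_Tk by (metis leI)
    have "(if \<forall>R\<in>Obj - T. B_bound t hs R \<le> Mk t hs T then Halt T else Sorted i0)
            \<in> CA_actions h k t Obj hs"
      unfolding CA_actions_def using test T by (simp only: if_False mem_Collect_eq) auto
    then show ?thesis by blast
  qed
qed

lemma ex_is_CA: "\<exists>A. is_CA cS cR k t A"
  unfolding is_CA_def
  by (rule exI[of _ "\<lambda>Obj hs. SOME a. a \<in> CA_actions (nat \<lfloor>cR / cS\<rfloor>) k t Obj hs"])
    (simp add: some_in_eq CA_actions_nonempty)

end

(*
  Let A be a correct algorithm that makes s sorted and r random accesses on a database D, let Y be
  its output, and let G consist of Y and the objects that A has accessed randomly, so that
  |G| <= k + r. Consider CA at a depth d > s, and an object R outside G that still has unknown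
  fields. Raising these fields slightly above the current bottom values makes the overall grade of
  R exceed B(R), while A does not notice the change; so B(R) is less than all overall grades in Y.
  If B(R) > M_k, then not all fields of all objects in Y can be known, and an object of Y with an
  unknown field has a B value greater than B(R). Hence CA picks only objects of G.

  CA can therefore pick an object at most |G| times beyond depth s. If it picks nothing and does
  not halt, then everything it has seen is completely known, all other objects are in G, and the
  rest of each list consists of objects of G and of objects that CA has accessed randomly, of which
  there are at most m * d / h. In both cases the final depth is at most a constant times
  s + h * r, up to an additive constant. Since the random accesses of CA cost at most twice as much
  as its sorted accesses, and h * cS <= cR, the optimality ratio depends on m only.
*)

theory Submission
  imports Defs
begin

section \<open>Strictly monotone functions on the unit cube\<close>

text \<open>Induction on the number of coordinates in which \<open>x\<close> and \<open>y\<close>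
  differ: replacing one of them by its value in \<open>y\<close> stays in the cube and raises
  \<open>t\<close>.\<close>

lemma strictly_monotone_less:
  fixes t :: "real ^ 'm::finite \<Rightarrow> real"
  assumes "strictly_monotone_each t" "y \<in> unit_cube"
    and "x \<in> unit_cube" "\<And>i. x $ i \<le> y $ i" "x \<noteq> y"
  shows "t x < t y"
  using assms(3-)
proof (induction "card {i. x $ i \<noteq> y $ i}" arbitrary: x rule: less_induct)
  case less
  obtain i where i: "x $ i \<noteq> y $ i" using less.prems(3) by (auto simp: vec_eq_iff)
  define z where "z = (\<chi> j. if j = i then y $ j else x $ j)"
  have z: "z \<in> unit_cube" using assms(2) less.prems(1) by (auto simp: unit_cube_def z_def)
  have xz: "t x < t z"
    using assms(1) less.prems(1) z i less.prems(2)[of i]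
    unfolding strictly_monotone_each_def by (auto simp: z_def intro!: exI[of _ i])
  show ?case
  proof (cases "z = y")
    case False
    have "card {j. z $ j \<noteq> y $ j} < card {j. x $ j \<noteq> y $ j}"
      using i by (intro psubset_card_mono) (auto simp: z_def)
    moreover have "z $ j \<le> y $ j" for j using less.prems(2) by (simp add: z_def)
    ultimately show ?thesis using less.hyps[of z] z False xz by auto
  qed (use xz in simp)
qed

lemma monotone_le:
  fixes t :: "real ^ 'm::finite \<Rightarrow> real"
  assumes "strictly_monotone_each t" "y \<in> unit_cube" "x \<in> unit_cube" "\<And>i. x $ i \<le> y $ i"
  shows "t x \<le> t y"
  using strictly_monotone_less[OF assms] by (cases "x = y") auto


section \<open>Histories\<close>

text \<open>The histories that some strategy could produce on \<open>D\<close>, so that facts about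
  knowledge can be proved without reference to a strategy.\<close>

inductive faithful :: "('a, 'm) database \<Rightarrow> ('a, 'm) history \<Rightarrow> bool" for D where
  Nil: "faithful D []"
| Sorted: "faithful D hs \<Longrightarrow> faithful D (hs @ [SortedRes i (sorted_answer D hs i)])"
| Random: "faithful D hs \<Longrightarrow> faithful D (hs @ [RandomRes R i (map_of (D i) R)])"

lemma run_0 [simp]: "run A D 0 = []"
  by (simp add: run_def)

lemma run_Suc: "run A D (Suc n) = step A D (run A D n)"
  by (simp add: run_def)

lemma sorted_count_Nil [simp]: "sorted_count [] i = 0"
  by (simp add: sorted_count_def)

lemma sorted_count_append [simp]:
  "sorted_count (hs @ [SortedRes j r]) i = sorted_count hs i + (if i = j then 1 else 0)"
  "sorted_count (hs @ [RandomRes R j v]) i = sorted_count hs i"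
  by (auto simp: sorted_count_def)

lemma learned_faithful:
  assumes "faithful D hs"
  shows "((R, i), x) \<in> set (concat (map learned hs)) \<longleftrightarrow>
    (R, x) \<in> set (take (sorted_count hs i) (D i)) \<or>
    map_of (D i) R = Some x \<and> (\<exists>r. RandomRes R i r \<in> set hs)"
  using assms
proof (induction rule: faithful.induct)
  case (Sorted hs j)
  show ?case
  proof (cases "sorted_count hs j < length (D j)")
    case True
    then have "set (take (Suc (sorted_count hs j)) (D j)) =
        insert (D j ! sorted_count hs j) (set (take (sorted_count hs j) (D j)))"
      by (simp add: take_Suc_conv_app_nth)
    then show ?thesis using Sorted.IH True
      by (cases "D j ! sorted_count hs j") (auto simp: sorted_answer_def)
  next
    case False
    then show ?thesis using Sorted.IH by (auto simp: sorted_answer_def)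
  qed
next
  case (Random hs R' j)
  then show ?case by (cases "map_of (D j) R'") auto
qed simp

text \<open>\<open>field\<close> takes the first matching entry of an association list. As names are
  distinct, every entry for \<open>(R, i)\<close> carries the value \<open>map_of (D i) R\<close>,
  so the order of the accesses does not matter.\<close>

lemma field_faithful:
  assumes "faithful D hs" "distinct (map fst (D i))"
  shows "field hs R i = Some x \<longleftrightarrow>
    (R, x) \<in> set (take (sorted_count hs i) (D i)) \<or>
    map_of (D i) R = Some x \<and> (\<exists>r. RandomRes R i r \<in> set hs)"
proof
  assume "field hs R i = Some x"
  then show "(R, x) \<in> set (take (sorted_count hs i) (D i)) \<or>
    map_of (D i) R = Some x \<and> (\<exists>r. RandomRes R i r \<in> set hs)"
    unfolding field_def using learned_faithful[OF assms(1)] map_of_SomeD by fast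
next
  assume "(R, x) \<in> set (take (sorted_count hs i) (D i)) \<or>
    map_of (D i) R = Some x \<and> (\<exists>r. RandomRes R i r \<in> set hs)"
  then have x: "((R, i), x) \<in> set (concat (map learned hs))"
    using learned_faithful[OF assms(1)] by fast
  then have "field hs R i \<noteq> None"
    unfolding field_def by (auto simp: map_of_eq_None_iff image_iff) force
  then obtain y where y: "field hs R i = Some y" by auto
  then have y': "((R, i), y) \<in> set (concat (map learned hs))"
    unfolding field_def by (rule map_of_SomeD)
  have "map_of (D i) R = Some z" if "((R, i), z) \<in> set (concat (map learned hs))" for z
    using that learned_faithful[OF assms(1)] assms(2)
    by (metis in_set_takeD map_of_is_SomeI)
  from this[OF x] this[OF y'] show "field hs R i = Some x" using y by simp
qed

lemma field_append:
  "field (hs @ [e]) R i = None \<Longrightarrow> field hs R i = None"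
  by (auto simp: field_def map_add_def split: option.splits)

lemma incomplete_append: "incomplete (hs @ [e]) R \<Longrightarrow> incomplete hs R"
  unfolding incomplete_def using field_append by metis

lemma bottom_values_faithful:
  assumes "faithful D hs"
  shows "[x. SortedRes j (Some (R, x)) \<leftarrow> hs, j = i] = map snd (take (sorted_count hs i) (D i))"
  using assms
proof (induction rule: faithful.induct)
  case (Sorted hs j)
  show ?case
  proof (cases "sorted_count hs j < length (D j)")
    case True
    then show ?thesis using Sorted.IH
      by (cases "D j ! sorted_count hs j") (auto simp: sorted_answer_def take_Suc_conv_app_nth)
  next
    case False
    then show ?thesis using Sorted.IH by (auto simp: sorted_answer_def)
  qed
qed simp_all

text \<open>Positions count from 0, hence the \<open>- 1\<close>. The two bounds on the count
  exclude the default value 1 and accesses past the end.\<close>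

lemma bottom_faithful:
  assumes "faithful D hs" "0 < sorted_count hs i" "sorted_count hs i \<le> length (D i)"
  shows "bottom hs i = snd (D i ! (sorted_count hs i - 1))"
proof -
  have "take (sorted_count hs i) (D i) \<noteq> []" using assms(2,3) by auto
  then show ?thesis
    unfolding bottom_def bottom_values_faithful[OF assms(1)] using assms(2,3)
    by (simp add: last_map last_conv_nth)
qed

lemma depth_eqI:
  assumes "sorted_count hs i = d" "\<And>j. d \<le> sorted_count hs j"
  shows "depth hs = d"
  unfolding depth_def using assms by (intro Min_eqI) auto

text \<open>Turns the nested conditionals of CA into four situations. \<open>continue\<close> covers
  both reasons for another round: too few objects seen, or a failed halting test.\<close>

lemma CA_actions_cases:
  assumes "a \<in> CA_actions h k t Obj hs"
  obtains (round) i where "a = Sorted i" "sorted_count hs i = depth hs"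
      "depth hs = 0 \<or> (\<exists>i. sorted_count hs i \<noteq> depth hs)"
  | (random) R i where "a = Random R i" "0 < depth hs" "\<And>i. sorted_count hs i = depth hs"
      "R \<in> targets h k t hs" "field hs R i = None"
  | (continue) i where "a = Sorted i" "0 < depth hs" "\<And>i. sorted_count hs i = depth hs"
      "targets h k t hs = {}"
      "card (seen hs) < k \<or> (\<exists>T. Tk k t hs T \<and> (\<exists>R\<in>Obj - T. Mk t hs T < B_bound t hs R))"
  | (halt) T where "a = Halt T" "0 < depth hs" "\<And>i. sorted_count hs i = depth hs"
      "Tk k t hs T" "\<And>R. R \<in> Obj - T \<Longrightarrow> B_bound t hs R \<le> Mk t hs T"
proof -
  consider (1) "depth hs = 0 \<or> (\<exists>i. sorted_count hs i \<noteq> depth hs)"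
    | (2) "0 < depth hs" "\<And>i. sorted_count hs i = depth hs" "targets h k t hs \<noteq> {}"
    | (3) "0 < depth hs" "\<And>i. sorted_count hs i = depth hs" "targets h k t hs = {}"
    by blast
  then show thesis
  proof cases
    case 1
    then show ?thesis using assms round by (auto simp: CA_actions_def)
  next
    case 2
    then show ?thesis using assms random by (auto simp: CA_actions_def)
  next
    case 3
    then have "a \<in> (if card (seen hs) < k then range Sorted
      else {a. \<exists>T. Tk k t hs T \<and>
        (if \<forall>R\<in>Obj - T. B_bound t hs R \<le> Mk t hs T then a = Halt T else a \<in> range Sorted)})"
      using assms by (simp add: CA_actions_def)
    then show ?thesis
      using continue[OF _ 3] halt[OF _ 3(1,2)]
      by (force split: if_splits simp: not_le[symmetric] simp del: not_le)
  qed
qed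


section \<open>Knowledge about a database with strictly decreasing lists\<close>

locale database =
  fixes D :: "('a, 'm::finite) database" and k :: nat and t :: "real ^ 'm \<Rightarrow> real"
  assumes db: "is_database k D" and dist: "distinctness D" and mono: "strictly_monotone_each t"
begin

abbreviation "N \<equiv> card (objs D)"

lemma distinct_objs: "distinct (map fst (D i))"
  using db by (simp add: is_database_def)

lemma fst_list: "fst ` set (D i) = objs D"
  using db by (simp add: is_database_def)

lemma finite_objs: "finite (objs D)"
  using fst_list by (metis List.finite_set finite_imageI)

lemma length_list [simp]: "length (D i) = N"
  using distinct_card[OF distinct_objs, of i] fst_list[of i] by simp

lemma grade_eq: "(R, x) \<in> set (D i) \<Longrightarrow> grade D R i = x"
  using map_of_is_SomeI[OF distinct_objs] by (fastforce simp: grade_def)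

lemma map_of_obj: "R \<in> objs D \<Longrightarrow> map_of (D i) R = Some (grade D R i)"
  using fst_list[of i] by (metis grade_def map_of_eq_None_iff option.exhaust_sel)

lemma map_of_objD: "map_of (D i) R = Some x \<Longrightarrow> R \<in> objs D \<and> x = grade D R i"
  using fst_list[of i] by (metis grade_eq image_eqI fst_conv map_of_SomeD)

lemma obj_position:
  assumes "R \<in> objs D"
  obtains j where "j < N" "D i ! j = (R, grade D R i)"
  using map_of_SomeD[OF map_of_obj[OF assms, of i]] by (metis in_set_conv_nth length_list)

lemma decreasing: "sorted_wrt (>) (map snd (D i))"
proof (unfold sorted_wrt_iff_nth_less, intro allI impI)
  fix j j' assume j: "j < j'" "j' < length (map snd (D i))"
  have "map snd (D i) ! j' \<le> map snd (D i) ! j"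
    using db j unfolding is_database_def sorted_wrt_iff_nth_less by auto
  moreover have "map snd (D i) ! j' \<noteq> map snd (D i) ! j"
    using dist j unfolding distinctness_def by (metis less_trans nat_neq_iff nth_eq_iff_index_eq)
  ultimately show "map snd (D i) ! j' < map snd (D i) ! j" by simp
qed

lemma nth_decreasing: "j < j' \<Longrightarrow> j' < N \<Longrightarrow> snd (D i ! j') < snd (D i ! j)"
  using decreasing[of i] by (auto simp: sorted_wrt_iff_nth_less)

lemma nth_unit: "j < N \<Longrightarrow> snd (D i ! j) \<in> {0..1}"
  using db unfolding is_database_def by (metis image_subset_iff length_list nth_mem)

lemma grade_unit: "R \<in> objs D \<Longrightarrow> grade D R i \<in> {0..1}"
  using obj_position nth_unit by (metis snd_conv)

lemma field_SomeD:
  "faithful D hs \<Longrightarrow> field hs R i = Some x \<Longrightarrow> R \<in> objs D \<and> x = grade D R i"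
  using field_faithful[of D hs i R x] distinct_objs[of i] map_of_objD
  by (metis in_set_takeD map_of_is_SomeI)

lemma seen_objs: "faithful D hs \<Longrightarrow> seen hs \<subseteq> objs D"
  using field_SomeD by (fastforce simp: seen_def)

lemma seenI: "field hs R i \<noteq> None \<Longrightarrow> R \<in> seen hs"
  by (auto simp: seen_def)

lemma field_top:
  assumes "faithful D hs" "j < sorted_count hs i" "j < N"
  shows "field hs (fst (D i ! j)) i \<noteq> None"
proof -
  have "D i ! j \<in> set (take (sorted_count hs i) (D i))"
    using assms by (auto simp: in_set_conv_nth)
  then show ?thesis using field_faithful[OF assms(1) distinct_objs] by (metis option.simps(3) prod.collapse)
qed

text \<open>An entry before position \<open>sorted_count hs i\<close> would have been revealed by
  sorted access, so a missing field sits in the unread part of the list.\<close>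

lemma missing_position:
  assumes "faithful D hs" "R \<in> objs D" "field hs R i = None"
  obtains j where "sorted_count hs i \<le> j" "j < N" "D i ! j = (R, grade D R i)"
  using obj_position[OF assms(2), of i] field_top[OF assms(1)] assms(3)
  by (metis fst_conv leI)

lemma complete_field:
  "faithful D hs \<Longrightarrow> \<not> incomplete hs R \<Longrightarrow> field hs R i = Some (grade D R i)"
  using field_SomeD by (fastforce simp: incomplete_def)

lemma complete_seen: "\<not> incomplete hs R \<Longrightarrow> R \<in> seen hs"
  by (auto simp: incomplete_def seen_def)

lemma W_complete: "faithful D hs \<Longrightarrow> \<not> incomplete hs R \<Longrightarrow> W_bound t hs R = overall t D R"
  by (simp add: W_bound_def overall_def complete_field)

lemma B_complete: "faithful D hs \<Longrightarrow> \<not> incomplete hs R \<Longrightarrow> B_bound t hs R = overall t D R"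
  by (simp add: B_bound_def overall_def complete_field)

section \<open>Lower and upper bounds on overall grades\<close>

lemma grades_cube: "R \<in> objs D \<Longrightarrow> (\<chi> i. grade D R i) \<in> unit_cube"
  using grade_unit by (simp add: unit_cube_def)

lemma W_le_overall:
  assumes "faithful D hs" "R \<in> objs D"
  shows "W_bound t hs R \<le> overall t D R"
  unfolding W_bound_def overall_def
proof (rule monotone_le[OF mono grades_cube[OF assms(2)]])
  show "(\<chi> i. case field hs R i of None \<Rightarrow> 0 | Some x \<Rightarrow> x) \<in> unit_cube"
    using field_SomeD[OF assms(1)] grade_unit[OF assms(2)]
    by (fastforce simp: unit_cube_def split: option.split)
  fix i
  show "(\<chi> i. case field hs R i of None \<Rightarrow> 0 | Some x \<Rightarrow> x) $ i \<le> (\<chi> i. grade D R i) $ i"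
    using field_SomeD[OF assms(1)] grade_unit[OF assms(2), of i]
    by (auto split: option.split)
qed

text \<open>What makes every bottom value the grade of an actual entry. That the lists are read to a
  common depth is required separately where needed.\<close>

definition level :: "('a, 'm) history \<Rightarrow> bool" where
  "level hs \<longleftrightarrow> faithful D hs \<and> (\<forall>i. 0 < sorted_count hs i \<and> sorted_count hs i \<le> N)"

lemma level_bottom: "level hs \<Longrightarrow> bottom hs i = snd (D i ! (sorted_count hs i - 1))"
  using bottom_faithful[of D hs i] by (simp add: level_def)

lemma bottom_unit: "level hs \<Longrightarrow> bottom hs i \<in> {0..1}"
  by (metis level_bottom level_def Suc_pred' nth_unit less_eq_Suc_le)

text \<open>Here distinctness yields strictness: the missing grade comes after the last entry read
  in a strictly decreasing list.\<close>

lemma bottom_greater: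
  assumes "level hs" "R \<in> objs D" "field hs R i = None"
  shows "grade D R i < bottom hs i"
proof -
  obtain j where j: "sorted_count hs i \<le> j" "j < N" "D i ! j = (R, grade D R i)"
    using missing_position assms by (metis level_def)
  moreover have "0 < sorted_count hs i" using assms(1) by (simp add: level_def)
  then have "sorted_count hs i - 1 < j" using j(1) by linarith
  ultimately show ?thesis using nth_decreasing level_bottom[OF assms(1)] by (metis snd_conv)
qed

lemma B_vector_cube:
  assumes "level hs"
  shows "(\<chi> i. case field hs R i of None \<Rightarrow> bottom hs i | Some x \<Rightarrow> x) \<in> unit_cube"
proof -
  have "faithful D hs" using assms by (simp add: level_def)
  then have "x \<in> {0..1}" if "field hs R i = Some x" for i x
    using field_SomeD[OF _ that] grade_unit by blast
  then show ?thesis using bottom_unit[OF assms] by (simp add: unit_cube_def split: option.split)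
qed

lemma overall_less_B:
  assumes "level hs" "R \<in> objs D" "incomplete hs R"
  shows "overall t D R < B_bound t hs R"
  unfolding overall_def B_bound_def
proof (rule strictly_monotone_less[OF mono B_vector_cube[OF assms(1)] grades_cube[OF assms(2)]])
  let ?B = "\<chi> i. case field hs R i of None \<Rightarrow> bottom hs i | Some x \<Rightarrow> x"
  show "(\<chi> i. grade D R i) $ i \<le> ?B $ i" for i
    using bottom_greater[OF assms(1,2), of i] field_SomeD assms(1)
    by (fastforce simp: level_def split: option.split)
  obtain i where "field hs R i = None" using assms(3) by (auto simp: incomplete_def)
  then have "(\<chi> i. grade D R i) $ i \<noteq> ?B $ i"
    using bottom_greater[OF assms(1,2), of i] by simp
  then show "(\<chi> i. grade D R i) \<noteq> ?B" by metis
qed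

lemma overall_le_B:
  assumes "level hs" "R \<in> objs D"
  shows "overall t D R \<le> B_bound t hs R"
  using overall_less_B[OF assms] B_complete assms(1) by (fastforce simp: level_def)

text \<open>The left side is the threshold value. Fields found by sorted access are at least the
  bottom value of their list, whereas a field found by random access may be smaller; this is why
  random accesses to \<open>R\<close> are excluded.\<close>

lemma threshold_le_B:
  assumes "level hs" "\<And>i r. RandomRes R i r \<notin> set hs"
  shows "t (\<chi> i. bottom hs i) \<le> B_bound t hs R"
  unfolding B_bound_def
proof (rule monotone_le[OF mono B_vector_cube[OF assms(1)]])
  show "(\<chi> i. bottom hs i) \<in> unit_cube" using bottom_unit[OF assms(1)] by (simp add: unit_cube_def)
  fix i
  show "(\<chi> i. bottom hs i) $ i \<le>
      (\<chi> i. case field hs R i of None \<Rightarrow> bottom hs i | Some x \<Rightarrow> x) $ i"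
  proof (cases "field hs R i")
    case (Some x)
    have f: "faithful D hs" using assms(1) by (simp add: level_def)
    have "(R, x) \<in> set (take (sorted_count hs i) (D i))"
      using Some field_faithful[OF f distinct_objs] assms(2) by blast
    then obtain j where j: "j < sorted_count hs i" "j < N" "D i ! j = (R, x)"
      by (auto simp: in_set_conv_nth)
    moreover have "0 < sorted_count hs i" "sorted_count hs i \<le> N"
      using assms(1) by (auto simp: level_def)
    ultimately have "j \<le> sorted_count hs i - 1" "sorted_count hs i - 1 < N" by linarith+
    then have "snd (D i ! (sorted_count hs i - 1)) \<le> snd (D i ! j)"
      using nth_decreasing by (metis le_neq_implies_less order.refl less_imp_le)
    then show ?thesis using Some j level_bottom[OF assms(1)] by simp
  qed simp
qed

lemma B_unseen: "R \<notin> seen hs \<Longrightarrow> B_bound t hs R = t (\<chi> i. bottom hs i)"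
  by (simp add: B_bound_def seen_def)

section \<open>The value \<open>Mk\<close> and the halting test\<close>

lemma Mk_le: "Tk j t hs T \<Longrightarrow> R \<in> T \<Longrightarrow> Mk t hs T \<le> W_bound t hs R"
  unfolding Mk_def by (rule Min_le) (auto simp: Tk_def intro: finite_subset[OF _ finite_seen])

lemma Mk_attained:
  assumes "Tk j t hs T" "j \<ge> 1"
  obtains R where "R \<in> T" "Mk t hs T = W_bound t hs R"
proof -
  have "finite T" "T \<noteq> {}" using assms by (auto simp: Tk_def intro: finite_subset[OF _ finite_seen])
  then have "Mk t hs T \<in> W_bound t hs ` T" unfolding Mk_def by (intro Min_in) auto
  then show thesis using that by auto
qed

lemma W_le_Mk:
  assumes "Tk j t hs T" "j \<ge> 1" "R \<in> seen hs" "R \<notin> T"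
  shows "W_bound t hs R \<le> Mk t hs T"
  using Mk_attained[OF assms(1,2)] assms(1,3,4) unfolding Tk_def
  by (metis DiffI less_eq_real_def)

text \<open>If \<open>Mk\<close> were below \<open>b\<close>, no member of \<open>Y\<close> could
  lie outside \<open>T\<close>, so \<open>Y = T\<close> by cardinality; but \<open>Mk\<close> is
  attained in \<open>T\<close>.\<close>

lemma Mk_greatest:
  assumes "Tk j t hs T" "j \<ge> 1" "Y \<subseteq> seen hs" "card Y = j" "\<And>R. R \<in> Y \<Longrightarrow> b \<le> W_bound t hs R"
  shows "b \<le> Mk t hs T"
proof (rule ccontr)
  assume "\<not> b \<le> Mk t hs T"
  then have less: "Mk t hs T < b" by simp
  have "Y \<subseteq> T"
    using W_le_Mk[OF assms(1,2)] assms(3,5) less by (metis leD order.strict_trans2 subset_iff)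
  moreover have "finite T" using assms(1) by (auto simp: Tk_def intro: finite_subset[OF _ finite_seen])
  ultimately have "Y = T" using assms(1,4) card_subset_eq[of T Y] by (simp add: Tk_def)
  then show False using Mk_attained[OF assms(1,2)] assms(5) less by (metis leD)
qed

lemma halt_correct:
  assumes "level hs" "Tk j t hs T" "j \<ge> 1" "\<And>R. R \<in> objs D - T \<Longrightarrow> B_bound t hs R \<le> Mk t hs T"
  shows "is_top_k j t D T"
  unfolding is_top_k_def
proof (intro conjI ballI)
  have f: "faithful D hs" using assms(1) by (simp add: level_def)
  show T: "T \<subseteq> objs D" "card T = j" using assms(2) seen_objs[OF f] by (auto simp: Tk_def)
  fix R R' assume R: "R \<in> T" "R' \<in> objs D - T"
  have "overall t D R' \<le> B_bound t hs R'" using overall_le_B[OF assms(1)] R by simp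
  also have "\<dots> \<le> Mk t hs T" by (rule assms(4)[OF R(2)])
  also have "\<dots> \<le> W_bound t hs R" by (rule Mk_le[OF assms(2) R(1)])
  also have "\<dots> \<le> overall t D R" using W_le_overall[OF f] R T by blast
  finally show "overall t D R' \<le> overall t D R" .
qed

end


section \<open>Raising the grade of one object\<close>

text \<open>Positions count from 0. The new grade lies strictly between those of the two neighbours, so
  that the grades of the list remain distinct.\<close>

definition raise :: "nat \<Rightarrow> 'a \<Rightarrow> ('a \<times> real) list \<Rightarrow> ('a \<times> real) list" where
  "raise n R L =
     take n L @ (R, (snd (L ! (n - 1)) + snd (L ! n)) / 2) # filter (\<lambda>p. fst p \<noteq> R) (drop n L)"

lemma map_of_filter_other:
  "R' \<noteq> R \<Longrightarrow> map_of (filter (\<lambda>p. fst p \<noteq> R) L) R' = map_of L R'"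
  by (induction L) auto

section \<open>Lists with one raised entry\<close>

context
  fixes n :: nat and R :: 'a and L :: "('a \<times> real) list"
  assumes n: "1 \<le> n" and R: "R \<in> fst ` set (drop n L)"
    and distinct: "distinct (map fst L)" and decreasing: "sorted_wrt (>) (map snd L)"
begin

lemma n_less: "n < length L"
  using R by (metis drop_all emptyE image_is_empty leI list.set(1))

lemma take_ge: "p \<in> set (take n L) \<Longrightarrow> snd (L ! (n - 1)) \<le> snd p"
proof -
  assume "p \<in> set (take n L)"
  then obtain j where j: "j < n" "L ! j = p" using n_less by (auto simp: in_set_conv_nth)
  show ?thesis
  proof (cases "j = n - 1")
    case False
    then have "j < n - 1" "n - 1 < length L" using j n_less by auto
    then show ?thesis using decreasing j by (auto simp: sorted_wrt_iff_nth_less less_imp_le)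
  qed (use j in simp)
qed

lemma drop_le: "p \<in> set (drop n L) \<Longrightarrow> snd p \<le> snd (L ! n)"
proof -
  assume "p \<in> set (drop n L)"
  then obtain j where "j < length L - n" "drop n L ! j = p" by (auto simp: in_set_conv_nth)
  then have j: "n + j < length L" "L ! (n + j) = p" using n_less by auto
  show ?thesis
  proof (cases "j = 0")
    case False
    then show ?thesis using decreasing j by (auto simp: sorted_wrt_iff_nth_less less_imp_le)
  qed (use j in simp)
qed

lemma neighbours: "snd (L ! n) < snd (L ! (n - 1))"
  using decreasing n n_less by (auto simp: sorted_wrt_iff_nth_less)

lemma raise_decreasing: "sorted_wrt (>) (map snd (raise n R L))"
proof -
  let ?x = "(snd (L ! (n - 1)) + snd (L ! n)) / 2"
  have "sorted_wrt (>) (map snd (take n L @ drop n L))" using decreasing by simp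
  then have s: "sorted_wrt (\<lambda>p q. snd p > snd q) (take n L)"
      "sorted_wrt (\<lambda>p q. snd p > snd q) (drop n L)"
    by (simp_all only: sorted_wrt_append sorted_wrt_map map_append)
  have hi: "?x < snd p" if "p \<in> set (take n L)" for p
    using take_ge[OF that] neighbours by (simp add: field_simps)
  have lo: "snd p < ?x" if "p \<in> set (drop n L)" for p
    using drop_le[OF that] neighbours by (simp add: field_simps)
  show ?thesis
    unfolding raise_def sorted_wrt_map sorted_wrt_append
    using s hi lo by (fastforce intro: sorted_wrt_filter less_trans)
qed

lemma R_notin_take: "R \<notin> fst ` set (take n L)"
proof
  assume "R \<in> fst ` set (take n L)"
  moreover have "distinct (map fst (take n L) @ map fst (drop n L))"
    using distinct by (metis append_take_drop_id map_append)
  ultimately show False using R unfolding distinct_append by (metis disjoint_iff list.set_map)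
qed

lemma distinct_raise: "distinct (map fst (raise n R L))"
proof -
  have "distinct (map fst (take n L) @ map fst (drop n L))"
    using distinct by (metis append_take_drop_id map_append)
  moreover from this have "distinct (map fst (filter (\<lambda>p. fst p \<noteq> R) (drop n L)))"
    by (simp add: distinct_map_filter)
  ultimately show ?thesis using R_notin_take by (auto simp: raise_def)
qed

lemma fst_raise: "fst ` set (raise n R L) = fst ` set L"
proof -
  have "fst ` set L = fst ` set (take n L) \<union> fst ` set (drop n L)"
    by (metis append_take_drop_id image_Un set_append)
  also have "\<dots> = fst ` set (raise n R L)" using R by (auto simp: raise_def)
  finally show ?thesis by simp
qed

lemma length_raise: "length (raise n R L) = length L"
  using distinct_card[OF distinct_raise] distinct_card[OF distinct] fst_raise by simp

lemma nth_raise: "j < n \<Longrightarrow> raise n R L ! j = L ! j"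
  using n_less by (simp add: raise_def nth_append)

lemma map_of_raise_other: "R' \<noteq> R \<Longrightarrow> map_of (raise n R L) R' = map_of L R'"
proof -
  assume "R' \<noteq> R"
  then have "map_of (raise n R L) R' = map_of (take n L @ drop n L) R'"
    unfolding raise_def map_of_append
    by (simp add: map_add_def map_of_filter_other split: option.split)
  then show ?thesis by simp
qed

text \<open>For \<open>n = d - 1\<close>, \<open>L ! n\<close> is the last entry that CA has read at
  depth \<open>d\<close>, so the raised grade exceeds the bottom value of the list.\<close>

lemma map_of_raise: obtains x where "map_of (raise n R L) R = Some x" "snd (L ! n) < x"
proof -
  have "map_of (raise n R L) R = Some ((snd (L ! (n - 1)) + snd (L ! n)) / 2)"
    using map_of_is_SomeI[OF distinct_raise] by (simp add: raise_def)
  moreover have "snd (L ! n) < (snd (L ! (n - 1)) + snd (L ! n)) / 2" using neighbours by simp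
  ultimately show thesis by (rule that)
qed

lemma snd_raise: "snd ` set L \<subseteq> {0..1} \<Longrightarrow> snd ` set (raise n R L) \<subseteq> {0..1}"
proof -
  assume L: "snd ` set L \<subseteq> {0..1}"
  then have "snd (L ! n) \<in> {0..1}" "snd (L ! (n - 1)) \<in> {0..1}"
    using n_less by (auto simp: image_subset_iff)
  then show ?thesis using L by (auto simp: raise_def dest!: in_set_takeD in_set_dropD)
qed

end


section \<open>Runs and final histories\<close>

lemma run_halted: "A (objs D) (run A D n) = Halt Y \<Longrightarrow> run A D (n + j) = run A D n"
  by (induction j) (auto simp: run_Suc step_def)

text \<open>The history is frozen once the strategy halts, so all halting times see the same
  history.\<close>

lemma outputs_unique:
  assumes "outputs A D Y" "outputs A D Y'"
  shows "Y = Y'"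
proof -
  obtain n n' where n: "A (objs D) (run A D n) = Halt Y" "A (objs D) (run A D n') = Halt Y'"
    using assms by (auto simp: outputs_def)
  then have "run A D n = run A D n'"
    using run_halted by (metis add_diff_inverse_nat less_imp_le not_le)
  then show ?thesis using n by simp
qed

lemma final_history_run:
  assumes "outputs A D Y"
  obtains n where "final_history A D = run A D n" "A (objs D) (run A D n) = Halt Y"
proof -
  let ?n = "LEAST n. \<exists>Y. A (objs D) (run A D n) = Halt Y"
  have "\<exists>Y. A (objs D) (run A D ?n) = Halt Y"
    by (rule LeastI_ex) (use assms in \<open>auto simp: outputs_def\<close>)
  then obtain Y' where Y': "A (objs D) (run A D ?n) = Halt Y'" by blast
  then have "Y' = Y" using outputs_unique assms by (metis outputs_def)
  then show thesis using that[of ?n] Y' by (simp add: final_history_def)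
qed

lemma sorted_count_step: "sorted_count hs i \<le> sorted_count (step A D hs) i"
  by (simp add: step_def split: action.split)

lemma set_step: "set hs \<subseteq> set (step A D hs)"
  by (auto simp: step_def split: action.split)

text \<open>A strategy sees a database only through the object names and the answers to its
  accesses. Lengths matter because they decide when sorted access yields
  \<open>None\<close>.\<close>

lemma run_cong:
  assumes "objs D' = objs D" "\<And>i. length (D' i) = length (D i)"
    and "\<And>i j. j < sorted_count (run A D n) i \<Longrightarrow> D' i ! j = D i ! j"
    and "\<And>R i r. RandomRes R i r \<in> set (run A D n) \<Longrightarrow> map_of (D' i) R = map_of (D i) R"
  shows "run A D' n = run A D n"
  using assms(3,4)
proof (induction n)
  case (Suc n)
  have "run A D' n = run A D n"
  proof (rule Suc.IH)
    show "D' i ! j = D i ! j" if "j < sorted_count (run A D n) i" for i j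
      using Suc.prems(1)[of j i] that sorted_count_step[of "run A D n" i A D]
      by (simp add: run_Suc)
    show "map_of (D' i) R = map_of (D i) R" if "RandomRes R i r \<in> set (run A D n)" for R i r
      using Suc.prems(2)[of R i r] that set_step[of "run A D n" A D]
      by (auto simp: run_Suc)
  qed
  then show ?case
  proof (cases "A (objs D) (run A D n)")
    case (Sorted i)
    then have "D' i ! sorted_count (run A D n) i = D i ! sorted_count (run A D n) i"
      using Suc.prems(1) by (simp add: run_Suc step_def)
    then show ?thesis using Sorted \<open>run A D' n = run A D n\<close> assms(1,2)
      by (simp add: run_Suc step_def sorted_answer_def)
  next
    case (Random R i)
    then have "map_of (D' i) R = map_of (D i) R"
      using Suc.prems(2)[of R i "map_of (D i) R"] by (simp add: run_Suc step_def)
    then show ?thesis using Random \<open>run A D' n = run A D n\<close> assms(1)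
      by (simp add: run_Suc step_def)
  qed (simp add: run_Suc step_def assms(1))
qed simp


section \<open>The adversary argument\<close>

context database
begin

text \<open>Raising the unknown fields of \<open>R\<close> slightly above the bottom values is not noticed by \<open>A\<close>,
  so that \<open>R\<close> must not overtake the output of \<open>A\<close>.\<close>

lemma adversary:
  assumes A: "finds_top_k k t {D. is_database k D \<and> distinctness D} A"
    and Y: "outputs A D Y" "R' \<in> Y"
    and hs: "level hs" "\<And>i. sorted_count hs i = d" "2 \<le> d"
    and final: "\<And>i. sorted_count (final_history A D) i < d"
      "\<And>i r. RandomRes R i r \<notin> set (final_history A D)"
    and R: "R \<in> objs D" "R \<notin> Y" "incomplete hs R"
  shows "B_bound t hs R < overall t D R'"
proof -
  have f: "faithful D hs" using hs(1) by (simp add: level_def)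
  \<comment> \<open>Index \<open>d - 1\<close> holds the last entry read by CA. \<open>A\<close> has
    read at most \<open>d - 1\<close> entries of each list and stops before this index;
    \<open>2 \<le> d\<close> provides the upper neighbour that \<open>raise\<close> uses.\<close>
  define D' where "D' = (\<lambda>i. if field hs R i = None then raise (d - 1) R (D i) else D i)"
  have d1: "1 \<le> d - 1" using hs(3) by simp
  have drop: "R \<in> fst ` set (drop (d - 1) (D i))" if none: "field hs R i = None" for i
  proof -
    obtain j where j: "d \<le> j" "j < N" "D i ! j = (R, grade D R i)"
      using missing_position[OF f R(1) none] hs(2) by metis
    then have "drop (d - 1) (D i) ! (j - (d - 1)) = (R, grade D R i)"
        "j - (d - 1) < length (drop (d - 1) (D i))"
      using hs(3) by auto
    then show ?thesis by (metis fst_conv image_eqI nth_mem)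
  qed
  note raise = d1 drop distinct_objs decreasing
  have fst': "fst ` set (D' i) = objs D" for i
    using fst_raise[OF raise] fst_list by (simp add: D'_def)
  have objs': "objs D' = objs D" using fst' by (simp add: objs_def)
  have dec': "sorted_wrt (>) (map snd (D' i))" for i
    using raise_decreasing[OF raise] decreasing by (simp add: D'_def)
  have distinct': "distinct (map fst (D' i))" for i
    using distinct_raise[OF raise] distinct_objs by (simp add: D'_def)
  have unit: "snd ` set (D i) \<subseteq> {0..1}" for i using db by (simp add: is_database_def)
  have unit': "snd ` set (D' i) \<subseteq> {0..1}" for i
    using snd_raise[OF raise unit] unit by (simp add: D'_def)
  have other': "map_of (D' i) Q = map_of (D i) Q" if "Q \<noteq> R" for Q i
    using map_of_raise_other[OF raise that] by (simp add: D'_def)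
  have db': "is_database k D'"
    unfolding is_database_def objs' using fst' distinct' unit' db
    by (auto simp: is_database_def intro!: sorted_wrt_mono_rel[OF _ dec'] less_imp_le)
  have dist': "distinctness D'"
    unfolding distinctness_def
  proof
    fix i
    have "sorted_wrt (<) (rev (map snd (D' i)))" using dec'[of i] by (simp add: sorted_wrt_rev)
    then show "distinct (map snd (D' i))" by (metis distinct_rev strict_sorted_iff)
  qed
  interpret D': database D' k t by unfold_locales (fact db' dist' mono)+

  obtain n where n: "final_history A D = run A D n" "A (objs D) (run A D n) = Halt Y"
    using final_history_run[OF Y(1)] .
  have "run A D' n = run A D n"
  proof (rule run_cong)
    show "length (D' i) = length (D i)" for i using length_raise[OF raise] by (simp add: D'_def)
    show "D' i ! j = D i ! j" if "j < sorted_count (run A D n) i" for i j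
      using nth_raise[OF raise, of i j] that final(1)[of i] n(1) by (simp add: D'_def)
    show "map_of (D' i) Q = map_of (D i) Q" if "RandomRes Q i r \<in> set (run A D n)" for Q i r
      using other' that final(2) n(1) by metis
  qed (fact objs')
  \<comment> \<open>\<open>A\<close> also receives the set of objects, which is the same for
    \<open>D'\<close>. Its correctness on \<open>D'\<close> and the uniqueness of outputs then make
    \<open>Y\<close> a top \<open>k\<close> answer for \<open>D'\<close> too.\<close>
  then have "outputs A D' Y" using n(2) objs' by (metis outputs_def)
  moreover obtain Y' where Y': "outputs A D' Y'" "is_top_k k t D' Y'"
    using A db' dist' by (auto simp: finds_top_k_def)
  ultimately have "is_top_k k t D' Y" using outputs_unique by metis
  then have top: "overall t D' R \<le> overall t D' R'"
    using Y(2) R(1,2) by (auto simp: is_top_k_def objs')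
  have same: "overall t D' R' = overall t D R'"
  proof -
    have "R' \<noteq> R" using Y(2) R(2) by blast
    then show ?thesis using other' by (simp add: overall_def grade_def)
  qed
  \<comment> \<open>At a known field the two vectors agree; at an unknown one the raised grade is
    strictly above the bottom value, and \<open>R\<close> has such a field.\<close>
  have "B_bound t hs R < overall t D' R"
    unfolding B_bound_def overall_def
  proof (rule strictly_monotone_less[OF mono D'.grades_cube B_vector_cube[OF hs(1)]])
    let ?B = "\<chi> i. case field hs R i of None \<Rightarrow> bottom hs i | Some x \<Rightarrow> x"
    show "R \<in> objs D'" using R(1) by (simp add: objs')
    have none: "?B $ i < (\<chi> i. grade D' R i) $ i" if none: "field hs R i = None" for i
    proof -
      obtain x where "map_of (raise (d - 1) R (D i)) R = Some x" "snd (D i ! (d - 1)) < x"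
        using map_of_raise[OF d1 drop[OF none] distinct_objs decreasing] .
      then show ?thesis using none level_bottom[OF hs(1), of i] hs(2) by (simp add: D'_def grade_def)
    qed
    show "?B $ i \<le> (\<chi> i. grade D' R i) $ i" for i
    proof (cases "field hs R i")
      case (Some x)
      then have "grade D' R i = grade D R i" by (simp add: grade_def D'_def)
      then show ?thesis using Some field_SomeD[OF f Some] by simp
    qed (use none[of i] in simp)
    obtain i where "field hs R i = None" using R(3) by (auto simp: incomplete_def)
    then show "?B \<noteq> (\<chi> i. grade D' R i)" using none by (metis less_irrefl)
  qed
  then show ?thesis using top same by simp
qed

text \<open>By \<open>adversary\<close>, all of \<open>Y\<close> beats
  \<open>B_bound t hs R\<close>. An incomplete member of \<open>Y\<close> would have an even larger
  B value: if seen, it would be a better candidate than \<open>R\<close>; if unseen, its B value is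
  only the threshold. So all of \<open>Y\<close> is complete, and these \<open>k\<close> objects
  lift \<open>Mk\<close> to at least \<open>B_bound t hs R\<close>.\<close>

lemma not_overlooked:
  assumes A: "finds_top_k k t {D. is_database k D \<and> distinctness D} A"
    and Y: "outputs A D Y" "is_top_k k t D Y" and k: "1 \<le> k"
    and hs: "level hs" "\<And>i. sorted_count hs i = d" "2 \<le> d"
      "\<And>R i r. RandomRes R i r \<in> set hs \<Longrightarrow> \<not> incomplete hs R"
    and final: "\<And>i. sorted_count (final_history A D) i < d"
      "\<And>i r. RandomRes R i r \<notin> set (final_history A D)"
    and R: "R \<in> objs D" "R \<notin> Y" "incomplete hs R"
    and T: "Tk k t hs T" "Mk t hs T < B_bound t hs R"
    and best: "\<And>R'. R' \<in> candidates k t hs \<Longrightarrow> B_bound t hs R' \<le> B_bound t hs R"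
  shows False
proof -
  have f: "faithful D hs" using hs(1) by (simp add: level_def)
  have less: "B_bound t hs R < overall t D R'" if "R' \<in> Y" for R'
    using adversary[OF A Y(1) that hs(1-3) final R] .
  have complete: "\<not> incomplete hs R'" if R': "R' \<in> Y" for R'
  proof
    assume inc: "incomplete hs R'"
    have "R' \<in> objs D" using Y(2) R' by (auto simp: is_top_k_def)
    then have B: "B_bound t hs R < B_bound t hs R'"
      using less[OF R'] overall_less_B[OF hs(1) _ inc] by fastforce
    show False
    proof (cases "R' \<in> seen hs")
      case True
      then have "R' \<in> candidates k t hs"
        using inc B T by (auto simp: candidates_def viable_def intro!: exI[of _ T])
      then show False using best B by fastforce
    next
      case False
      \<comment> \<open>\<open>R\<close> is incomplete, so CA has not accessed it randomly, and its
        B value is at least the threshold.\<close>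
      then show False using B_unseen threshold_le_B[OF hs(1)] hs(4) R(3) B by (metis leD)
    qed
  qed
  have "B_bound t hs R \<le> Mk t hs T"
  proof (rule Mk_greatest[OF T(1) k])
    show "Y \<subseteq> seen hs" using complete complete_seen[of hs] by fast
    show "card Y = k" using Y(2) by (simp add: is_top_k_def)
    show "B_bound t hs R \<le> W_bound t hs R'" if "R' \<in> Y" for R'
      using less[OF that] W_complete[OF f complete[OF that]] by simp
  qed
  then show False using T(2) by simp
qed

end


section \<open>Runs of CA\<close>

lemma length_filter_sorted:
  fixes hs :: "('a, 'm::finite) history"
  shows "length (filter is_sorted hs) = (\<Sum>i\<in>UNIV. sorted_count hs i)"
proof (induction hs rule: rev_induct)
  case (snoc e hs)
  then show ?case by (cases e) (simp_all add: sum.distrib)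
qed simp

lemma length_history:
  "length hs = length (filter is_sorted hs) + length (filter is_random hs)"
proof (induction hs)
  case (Cons e hs)
  then show ?case by (cases e) simp_all
qed simp

abbreviation random_objs :: "('a, 'm) history \<Rightarrow> 'a set" where
  "random_objs hs \<equiv> {R. \<exists>i r. RandomRes R i r \<in> set hs}"

lemma card_random_objs:
  "finite (random_objs hs)" "card (random_objs hs) \<le> length (filter is_random hs)"
proof -
  let ?S = "(\<lambda>e. case e of RandomRes R _ _ \<Rightarrow> R) ` set (filter is_random hs)"
  have sub: "random_objs hs \<subseteq> ?S" by force
  then show "finite (random_objs hs)" by (rule finite_subset) simp
  have "card (random_objs hs) \<le> card ?S" by (rule card_mono[OF _ sub]) simp
  also have "\<dots> \<le> card (set (filter is_random hs))" by (rule card_image_le) simp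
  also have "\<dots> \<le> length (filter is_random hs)" by (rule card_length)
  finally show "card (random_objs hs) \<le> length (filter is_random hs)" .
qed

text \<open>Costs do not occur here: \<open>h\<close> is any positive number, tied to
  \<open>cR / cS\<close> only in the final theorem.\<close>

locale CA_run = database D k t for D :: "('a, 'm::finite) database" and k t +
  fixes h :: nat and CA :: "('a, 'm) algorithm"
  assumes CA: "CA (objs D) hs \<in> CA_actions h k t (objs D) hs"
    and k: "1 \<le> k" and h: "1 \<le> h"
begin

lemma N_pos: "0 < N"
  using db k by (simp add: is_database_def)

text \<open>\<open>in_round hs d X\<close>: \<open>d\<close> depths are dealt with, and the lists in \<open>X\<close> have been read at depth
  \<open>d + 1\<close>.\<close>

definition in_round :: "('a, 'm) history \<Rightarrow> nat \<Rightarrow> 'm set \<Rightarrow> bool" where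
  "in_round hs d X \<longleftrightarrow> faithful D hs \<and> (\<forall>i. sorted_count hs i = d + (if i \<in> X then 1 else 0)) \<and>
     d < N \<and> (X = {} \<longrightarrow> d = 0) \<and> (hs = [] \<or> is_sorted (last hs)) \<and>
     (\<forall>R i r. RandomRes R i r \<in> set hs \<longrightarrow> \<not> incomplete hs R)"

text \<open>\<open>picked hs d R\<close>: the object picked at depth \<open>d\<close> is \<open>R\<close>, whose missing fields are being
  requested.\<close>

definition picked :: "('a, 'm) history \<Rightarrow> nat \<Rightarrow> 'a \<Rightarrow> bool" where
  "picked hs d R \<longleftrightarrow> faithful D hs \<and> (\<forall>i. sorted_count hs i = d) \<and> 0 < d \<and> d \<le> N \<and>
     R \<in> objs D \<and> (\<exists>i r. last hs = RandomRes R i r) \<and>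
     (\<forall>R' i r. RandomRes R' i r \<in> set hs \<longrightarrow> R' = R \<or> \<not> incomplete hs R')"

abbreviation randoms :: "('a, 'm) history \<Rightarrow> nat" where
  "randoms hs \<equiv> length (filter is_random hs)"

abbreviation missing :: "('a, 'm) history \<Rightarrow> 'a \<Rightarrow> 'm set" where
  "missing hs R \<equiv> {i. field hs R i = None}"

abbreviation unknown :: "'a set \<Rightarrow> ('a, 'm) history \<Rightarrow> 'a set" where
  "unknown G hs \<equiv> {R \<in> G. incomplete hs R}"

text \<open>The number of multiples of \<open>h\<close> among the depths \<open>\<ge> h * j0\<close> that are dealt with is
  \<open>d div h + 1 - j0\<close>. At each of them an object of \<open>G\<close> has been completed.\<close>

definition invariant :: "'a set \<Rightarrow> nat \<Rightarrow> ('a, 'm) history \<Rightarrow> bool" where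
  "invariant G j0 hs \<longleftrightarrow>
     (\<exists>d X. in_round hs d X \<and> randoms hs \<le> CARD('m) * (d div h) \<and>
        card (unknown G hs) + (d div h + 1 - j0) \<le> card G) \<or>
     (\<exists>d R. picked hs d R \<and> randoms hs + card (missing hs R) \<le> CARD('m) * (d div h) \<and>
        card (unknown G hs - {R}) + (d div h + 1 - j0) \<le> card G)"

abbreviation continues :: "('a, 'm) history \<Rightarrow> bool" where
  "continues hs \<equiv>
     card (seen hs) < k \<or> (\<exists>T. Tk k t hs T \<and> (\<exists>R\<in>objs D - T. Mk t hs T < B_bound t hs R))"

text \<open>The interface between the adversary argument and the counting: from depth
  \<open>h * j0\<close> on, every pick must come from \<open>G\<close>. The upper limit
  \<open>j0 + card G\<close> is harmless, because the invariant keeps \<open>Suc d div h\<close>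
  within it, and it bounds the size of the exceptional databases.\<close>

definition charged :: "'a set \<Rightarrow> nat \<Rightarrow> bool" where
  "charged G j0 \<longleftrightarrow> finite G \<and> 1 \<le> j0 \<and> (\<forall>hs d. in_round hs d UNIV \<longrightarrow> randoms hs \<le> CARD('m) * (d div h) \<longrightarrow>
     h dvd Suc d \<longrightarrow> j0 \<le> Suc d div h \<longrightarrow> Suc d div h \<le> j0 + card G \<longrightarrow>
     targets h k t hs \<subseteq> G \<and> \<not> (targets h k t hs = {} \<and> continues hs))"

lemma in_round_level:
  assumes "in_round hs d UNIV"
  shows "level hs" "\<And>i. sorted_count hs i = Suc d" "depth hs = Suc d" "\<exists>i r. last hs = SortedRes i r"
proof -
  show 1: "sorted_count hs i = Suc d" for i using assms by (simp add: in_round_def)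
  then show "depth hs = Suc d" by (intro depth_eqI) auto
  show "level hs" using assms by (simp add: in_round_def level_def)
  have "hs \<noteq> []" using 1 by fastforce
  then show "\<exists>i r. last hs = SortedRes i r"
    using assms by (cases "last hs") (auto simp: in_round_def)
qed

lemma picked_level:
  assumes "picked hs d R"
  shows "level hs" "\<And>i. sorted_count hs i = d" "depth hs = d"
  using assms by (auto simp: picked_def level_def intro: depth_eqI)

text \<open>A completed round is represented by \<open>X = UNIV\<close>, not by
  \<open>X = {}\<close> at the next \<open>d\<close>; the empty set occurs only at the start, where
  the depth is 0.\<close>

lemma in_round_full:
  assumes "in_round hs d X" "0 < depth hs" "\<And>i. sorted_count hs i = depth hs"
  shows "X = UNIV"
proof (cases "X = {}")
  case True
  then have "sorted_count hs i = 0" for i using assms(1) by (simp add: in_round_def)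
  then show ?thesis using assms(2,3) by simp
next
  case False
  then obtain i where i: "i \<in> X" by blast
  have "j \<in> X" for j
    using assms(1) assms(3)[of i] assms(3)[of j] i by (auto simp: in_round_def split: if_splits)
  then show ?thesis by blast
qed

text \<open>With all lists exhausted every object is complete, so B and W values coincide and the
  halting test succeeds. This keeps the depth of CA within \<open>N\<close>.\<close>

lemma bottom_of_lists:
  assumes "level hs" "\<And>i. sorted_count hs i = N"
  shows "\<not> continues hs"
proof -
  have f: "faithful D hs" using assms(1) by (simp add: level_def)
  have complete: "\<not> incomplete hs R" if "R \<in> objs D" for R
    using missing_position[OF f that] assms(2) unfolding incomplete_def by (metis leD)
  have seen: "seen hs = objs D" using seen_objs[OF f] complete complete_seen[of hs] by fast
  have "k \<le> N" using db by (simp add: is_database_def)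
  moreover have "B_bound t hs R \<le> Mk t hs T" if "Tk k t hs T" "R \<in> objs D - T" for T R
    using W_le_Mk[OF that(1) k] that(2) seen complete W_complete[OF f] B_complete[OF f]
    by (metis DiffE)
  ultimately show ?thesis using seen by (metis leD)
qed

lemma in_round_sorted:
  assumes "faithful D hs" "\<And>i. sorted_count hs i = d + (if i \<in> X then 1 else 0)" "d < N" "i \<notin> X"
    and "\<And>R i r. RandomRes R i r \<in> set hs \<Longrightarrow> \<not> incomplete hs R"
  shows "in_round (hs @ [SortedRes i (sorted_answer D hs i)]) d (insert i X)"
  unfolding in_round_def
  using assms faithful.Sorted[OF assms(1)] incomplete_append by (fastforce split: if_splits)

lemma unknown_append: "finite G \<Longrightarrow> card (unknown G (hs @ [e])) \<le> card (unknown G hs)"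
  using incomplete_append by (intro card_mono) auto

text \<open>Each random access uses up a missing field, so the sum of \<open>randoms\<close> and the
  number of missing fields does not grow.\<close>

lemma picked_random:
  assumes "faithful D hs" "\<And>i. sorted_count hs i = d" "0 < d" "d \<le> N" "R \<in> objs D"
    and "\<And>R' i r. RandomRes R' i r \<in> set hs \<Longrightarrow> R' = R \<or> \<not> incomplete hs R'"
    and "field hs R i = None"
  defines "hs' \<equiv> hs @ [RandomRes R i (map_of (D i) R)]"
  shows "picked hs' d R" "card (missing hs' R) < card (missing hs R)"
proof -
  have f: "faithful D hs'" unfolding hs'_def by (rule faithful.Random[OF assms(1)])
  show "picked hs' d R"
    unfolding picked_def using f assms(2-5) assms(6) incomplete_append[of hs]
    by (auto simp: hs'_def) blast
  have "field hs' R i \<noteq> None"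
    using field_faithful[OF f distinct_objs] map_of_obj[OF assms(5)] by (auto simp: hs'_def)
  moreover have "missing hs' R \<subseteq> missing hs R"
    unfolding hs'_def by (auto dest: field_append)
  moreover have "i \<in> missing hs R" using assms(7) by simp
  ultimately have "missing hs' R \<subset> missing hs R" by (metis (mono_tags) mem_Collect_eq psubsetI)
  then show "card (missing hs' R) < card (missing hs R)" by (intro psubset_card_mono) auto
qed

text \<open>A pick at a multiple of \<open>h\<close> raises \<open>d div h\<close> by one. This pays
  for its at most \<open>CARD('m)\<close> random accesses; from \<open>j0\<close> on, the picked
  object of \<open>G\<close> also ceases to count as unknown, which offsets the growth of the second
  sum. \<open>charged\<close> rules out passing such a depth without a pick.\<close>

lemma invariant_step:
  assumes inv: "invariant G j0 hs" and ch: "charged G j0"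
  shows "invariant G j0 (step CA D hs)"
proof -
  have fin: "finite G" using ch by (simp add: charged_def)
  from inv consider
      (in_round) d X where "in_round hs d X" "randoms hs \<le> CARD('m) * (d div h)"
        "card (unknown G hs) + (d div h + 1 - j0) \<le> card G"
    | (picked) d R where "picked hs d R" "randoms hs + card (missing hs R) \<le> CARD('m) * (d div h)"
        "card (unknown G hs - {R}) + (d div h + 1 - j0) \<le> card G"
    unfolding invariant_def by blast
  then show ?thesis
  proof cases
    case in_round
    note counts = in_round(1)[unfolded in_round_def]
    have clean: "\<And>R i r. RandomRes R i r \<in> set hs \<Longrightarrow> \<not> incomplete hs R" using counts by blast
    show ?thesis
      using CA[of hs]
    proof (cases rule: CA_actions_cases)
      case (round i)
      have "X \<noteq> UNIV" using in_round_level[of hs d] in_round(1) round(3) by auto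
      then obtain j where "j \<notin> X" by blast
      then have "depth hs = d" using counts by (intro depth_eqI[of _ j]) auto
      then have "i \<notin> X" using round(2) counts by (auto split: if_splits)
      then have "in_round (step CA D hs) d (insert i X)"
        using in_round_sorted[of hs d X i] counts round(1) by (simp add: step_def)
      moreover have "card (unknown G (step CA D hs)) \<le> card (unknown G hs)"
        using unknown_append[OF fin] round(1) by (simp add: step_def)
      moreover have "randoms (step CA D hs) = randoms hs" using round(1) by (simp add: step_def)
      ultimately show ?thesis using in_round(2,3) unfolding invariant_def by fastforce
    next
      case (random R i)
      have X: "X = UNIV" using in_round_full[OF in_round(1) random(2,3)] .
      note level = in_round_level[OF in_round(1)[unfolded X]]
      have target: "h dvd Suc d" "R \<in> seen hs" "incomplete hs R"
        using level(3,4) random(4) by (auto simp: targets_def candidates_def split: if_splits)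
      then have div: "Suc d div h = Suc (d div h)" by (simp add: div_Suc mod_eq_0_iff_dvd)
      have R: "R \<in> objs D" using target(2) seen_objs counts by blast
      let ?hs = "hs @ [RandomRes R i (map_of (D i) R)]"
      have step: "step CA D hs = ?hs" using random(1) by (simp add: step_def)
      have p: "picked ?hs (Suc d) R" "card (missing ?hs R) < card (missing hs R)"
        using picked_random[of hs "Suc d" R i] counts level(2) clean R random(5) by auto
      have "card (missing hs R) \<le> CARD('m)" by (simp add: card_mono)
      then have "randoms ?hs + card (missing ?hs R) \<le> CARD('m) * (Suc d div h)"
        using p(2) in_round(2) div by simp
      moreover have "card (unknown G ?hs - {R}) + (Suc d div h + 1 - j0) \<le> card G"
      proof (cases "j0 \<le> Suc d div h")
        case True
        then have "R \<in> G"
          using ch in_round X target(1) random(4) div unfolding charged_def by fastforce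
        then have "card (unknown G hs) = Suc (card (unknown G hs - {R}))"
          using fin target(3) by (intro card.remove) auto
        moreover have "card (unknown G ?hs - {R}) \<le> card (unknown G hs - {R})"
          using fin incomplete_append by (intro card_mono) auto
        ultimately show ?thesis using in_round(3) div True by simp
      next
        \<comment> \<open>Before \<open>j0\<close> the truncated difference is 0.\<close>
        case False
        then show ?thesis using fin by (auto intro!: card_mono)
      qed
      ultimately show ?thesis unfolding invariant_def step
        by (intro disjI2 exI[of _ "Suc d"] exI[of _ R] conjI p(1))
    next
      case (continue i)
      have X: "X = UNIV" using in_round_full[OF in_round(1) continue(2,3)] .
      note level = in_round_level[OF in_round(1)[unfolded X]]
      have "Suc d < N"
        using bottom_of_lists[OF level(1)] level(2) continue(5) counts by (metis Suc_lessI)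
      then have r: "in_round (step CA D hs) (Suc d) {i}"
        using in_round_sorted[of hs "Suc d" "{}" i] counts level(2) continue(1) by (simp add: step_def)
      have "d div h \<le> Suc d div h" by (simp add: div_le_mono)
      then have "randoms hs \<le> CARD('m) * (Suc d div h)"
        using in_round(2) by (meson mult_le_mono2 order_trans)
      then have "randoms (step CA D hs) \<le> CARD('m) * (Suc d div h)"
        using continue(1) by (simp add: step_def)
      moreover have "card (unknown G hs) + (Suc d div h + 1 - j0) \<le> card G"
      proof (cases "h dvd Suc d \<and> j0 \<le> Suc d div h")
        case True
        then have "Suc d div h = Suc (d div h)" by (simp add: div_Suc mod_eq_0_iff_dvd)
        then have False
          using True ch in_round X continue(4,5) unfolding charged_def by fastforce
        then show ?thesis ..
      next
        \<comment> \<open>Either \<open>Suc d\<close> is no multiple of \<open>h\<close> and the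
          quotient stays the same, or the truncated difference is 0.\<close>
        case False
        then have "Suc d div h = d div h \<or> Suc d div h + 1 - j0 = 0"
          by (auto simp: div_Suc mod_eq_0_iff_dvd)
        then show ?thesis
          using in_round(3) fin by (elim disjE) (auto intro!: card_mono)
      qed
      moreover have "card (unknown G (step CA D hs)) \<le> card (unknown G hs)"
        using unknown_append[OF fin] continue(1) by (simp add: step_def)
      ultimately show ?thesis using r unfolding invariant_def by fastforce
    next
      case (halt T)
      then show ?thesis using inv by (simp add: step_def)
    qed
  next
    case picked
    note counts = picked(1)[unfolded picked_def]
    note level = picked_level[OF picked(1)]
    show ?thesis
      using CA[of hs]
    proof (cases rule: CA_actions_cases)
      case (round i)
      then show ?thesis using level counts by simp
    next
      case (random R' i)
      then have "R' = R" using counts by (auto simp: targets_def)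
      let ?hs = "hs @ [RandomRes R i (map_of (D i) R)]"
      have step: "step CA D hs = ?hs" using random(1) \<open>R' = R\<close> by (simp add: step_def)
      have p: "picked ?hs d R" "card (missing ?hs R) < card (missing hs R)"
        using picked_random[of hs d R i] counts random(5) \<open>R' = R\<close> by auto
      then have "randoms ?hs + card (missing ?hs R) \<le> CARD('m) * (d div h)" using picked(2) by simp
      moreover have "card (unknown G ?hs - {R}) \<le> card (unknown G hs - {R})"
        using fin incomplete_append by (intro card_mono) auto
      ultimately show ?thesis using p(1) step picked(3) unfolding invariant_def by fastforce
    next
      case (continue i)
      have R: "\<not> incomplete hs R" using continue(4) counts by (auto simp: targets_def)
      then have clean: "\<And>R i r. RandomRes R i r \<in> set hs \<Longrightarrow> \<not> incomplete hs R" using counts by blast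
      have "d < N"
        using bottom_of_lists[OF level(1)] level(2) continue(5) counts by (metis le_neq_implies_less)
      then have r: "in_round (step CA D hs) d {i}"
        using in_round_sorted[of hs d "{}" i] counts clean continue(1) by (simp add: step_def)
      have "unknown G hs - {R} = unknown G hs" using R by blast
      moreover have "card (unknown G (step CA D hs)) \<le> card (unknown G hs)"
        using unknown_append[OF fin] continue(1) by (simp add: step_def)
      moreover have "randoms (step CA D hs) = randoms hs" using continue(1) by (simp add: step_def)
      ultimately show ?thesis using r picked(2,3) unfolding invariant_def by fastforce
    next
      case (halt T)
      then show ?thesis using inv by (simp add: step_def)
    qed
  qed
qed

section \<open>Termination and correctness of CA\<close>

lemma invariant_run:
  assumes "charged G j0"
  shows "invariant G j0 (run CA D n)"
proof (induction n)
  case 0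
  have "card (unknown G []) \<le> card G"
    using assms by (intro card_mono) (auto simp: charged_def)
  moreover have "in_round [] 0 {}" using N_pos by (simp add: in_round_def faithful.Nil)
  \<comment> \<open>This makes \<open>0 div h + 1 - j0\<close> vanish at the start.\<close>
  moreover have "1 \<le> j0" using assms by (simp add: charged_def)
  ultimately show ?case
    unfolding invariant_def by (intro disjI1 exI[of _ 0] exI[of _ "{}"]) simp
next
  case (Suc n)
  then show ?case using invariant_step assms by (simp add: run_Suc)
qed

text \<open>CA may halt at depth \<open>Suc d\<close> while the invariant counts only
  \<open>d\<close> depths as dealt with, so the quotient can be one larger than the invariant gives:
  hence \<open>j0 + card G\<close>.\<close>

lemma halting_history:
  assumes "charged G j0" "CA (objs D) (run CA D n) = Halt T"
  obtains d where "\<And>i. sorted_count (run CA D n) i = d" "d \<le> N" "d div h \<le> j0 + card G"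
    "randoms (run CA D n) \<le> CARD('m) * (d div h)" "is_top_k k t D T"
proof -
  let ?hs = "run CA D n"
  have halt: "0 < depth ?hs" "\<And>i. sorted_count ?hs i = depth ?hs" "Tk k t ?hs T"
      "\<And>R. R \<in> objs D - T \<Longrightarrow> B_bound t ?hs R \<le> Mk t ?hs T"
    using CA[of ?hs] assms(2) by (cases rule: CA_actions_cases; simp)+
  from invariant_run[OF assms(1), of n] consider
      (in_round) d X where "in_round ?hs d X" "randoms ?hs \<le> CARD('m) * (d div h)"
        "card (unknown G ?hs) + (d div h + 1 - j0) \<le> card G"
    | (picked) d R where "picked ?hs d R"
        "randoms ?hs + card (missing ?hs R) \<le> CARD('m) * (d div h)"
        "card (unknown G ?hs - {R}) + (d div h + 1 - j0) \<le> card G"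
    unfolding invariant_def by blast
  then show thesis
  proof cases
    case in_round
    then have X: "X = UNIV" using in_round_full halt(1,2) by blast
    note level = in_round_level[OF in_round(1)[unfolded X]]
    have "Suc d div h \<le> Suc (d div h)" by (simp add: div_Suc)
    moreover have "d div h \<le> Suc d div h" by (simp add: div_le_mono)
    then have "randoms ?hs \<le> CARD('m) * (Suc d div h)"
      using in_round(2) by (meson mult_le_mono2 order_trans)
    moreover have "Suc d \<le> N" using in_round(1) by (simp add: in_round_def)
    ultimately show ?thesis
      using that[of "Suc d"] level(2) in_round(3) halt_correct[OF level(1) halt(3) k halt(4)] by simp
  next
    case picked
    note level = picked_level[OF picked(1)]
    have "d \<le> N" using picked(1) by (simp add: picked_def)
    then show ?thesis
      using that[of d] level(2) picked(2,3) halt_correct[OF level(1) halt(3) k halt(4)] by simp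
  qed
qed

text \<open>No depth up to \<open>N\<close> has a quotient as large as \<open>Suc N\<close>, so the
  condition is vacuous. The invariant thus becomes available without a competing algorithm.\<close>

lemma trivially_charged: "charged {} (Suc N)"
proof -
  have "Suc d div h < Suc N" if "d < N" for d
    using that div_le_dividend[of "Suc d" h] by linarith
  then show ?thesis by (auto simp: charged_def in_round_def not_le[symmetric])
qed

lemma length_run:
  assumes "\<And>n Y. CA (objs D) (run CA D n) \<noteq> Halt Y"
  shows "length (run CA D n) = n"
proof (induction n)
  case (Suc n)
  then show ?case using assms[of n] by (cases "CA (objs D) (run CA D n)") (auto simp: run_Suc step_def)
qed simp

lemma length_run_le: "length (run CA D n) \<le> CARD('m) * N + CARD('m) * N"
proof -
  let ?hs = "run CA D n"
  have div: "CARD('m) * (d div h) \<le> CARD('m) * N" if "d \<le> N" for d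
    using that div_le_dividend[of d h] by (intro mult_le_mono2) linarith
  have *: "(\<forall>i. sorted_count ?hs i \<le> N) \<and> randoms ?hs \<le> CARD('m) * N"
    using invariant_run[OF trivially_charged, of n] unfolding invariant_def
  proof (elim disjE exE conjE)
    fix d X assume "in_round ?hs d X" "randoms ?hs \<le> CARD('m) * (d div h)"
    moreover from this have "d < N" "sorted_count ?hs i \<le> Suc d" for i by (auto simp: in_round_def)
    ultimately show ?thesis using div[of d] by (meson less_eq_Suc_le less_imp_le order_trans)
  next
    fix d R assume r: "picked ?hs d R" "randoms ?hs + card (missing ?hs R) \<le> CARD('m) * (d div h)"
    then have d: "d \<le> N" "\<And>i. sorted_count ?hs i = d" by (auto simp: picked_def)
    then have "randoms ?hs \<le> CARD('m) * N" using r(2) div[OF d(1)] by linarith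
    then show ?thesis using d by simp
  qed
  have "(\<Sum>i\<in>UNIV. sorted_count ?hs i) \<le> CARD('m) * N"
    using sum_bounded_above[of "UNIV :: 'm set" "sorted_count ?hs" N] * by simp
  then show ?thesis
    unfolding length_history[of ?hs] length_filter_sorted using * by (intro add_mono) auto
qed

text \<open>A run that never halts makes one access per step, but the invariant bounds the number of
  accesses.\<close>

lemma CA_correct: "\<exists>Y. outputs CA D Y \<and> is_top_k k t D Y"
proof -
  have "\<exists>n Y. CA (objs D) (run CA D n) = Halt Y"
    using length_run length_run_le by (metis Suc_n_not_le_n)
  then obtain n Y where n: "CA (objs D) (run CA D n) = Halt Y" by blast
  then have "is_top_k k t D Y" using halting_history[OF trivially_charged n] by blast
  then show ?thesis using n by (auto simp: outputs_def)
qed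

lemma final_history_bound:
  assumes "charged G j0"
  obtains d where "length (filter is_sorted (final_history CA D)) = CARD('m) * d"
    "randoms (final_history CA D) \<le> CARD('m) * (d div h)" "d \<le> N" "d div h \<le> j0 + card G"
proof -
  obtain Y n where n: "final_history CA D = run CA D n" "CA (objs D) (run CA D n) = Halt Y"
    using CA_correct final_history_run by metis
  obtain d where d: "\<And>i. sorted_count (run CA D n) i = d" "d \<le> N" "d div h \<le> j0 + card G"
      "randoms (run CA D n) \<le> CARD('m) * (d div h)"
    using halting_history[OF assms n(2)] by metis
  then show thesis using that[of d] n(1) by (simp add: length_filter_sorted)
qed

section \<open>CA beyond the depth of a competing algorithm\<close>

lemma depth_le_seen:
  assumes "level hs" "\<And>i. sorted_count hs i = d"
  shows "d \<le> card (seen hs)"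
proof -
  obtain i :: 'm where True by simp
  have d: "d \<le> N" "faithful D hs" using assms by (auto simp: level_def)
  have "distinct (map fst (take d (D i)))" using distinct_objs by (metis distinct_take take_map)
  from distinct_card[OF this] have "card (fst ` set (take d (D i))) = d" using d by simp
  moreover have "fst ` set (take d (D i)) \<subseteq> seen hs"
  proof
    fix R assume "R \<in> fst ` set (take d (D i))"
    then obtain j where "j < d" "j < N" "R = fst (D i ! j)" by (auto simp: in_set_conv_nth)
    then show "R \<in> seen hs" using field_top[OF d(2)] assms(2) seenI by metis
  qed
  ultimately show ?thesis using finite_seen card_mono by metis
qed

text \<open>If CA picks nothing although it must go on, then it knows all fields of the objects that it
  has seen, and all other objects belong to \<open>G\<close>. The part of a list that has not been read then
  consists of objects of \<open>G\<close> and objects that CA has accessed randomly.\<close>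

lemma few_objects_left:
  assumes "in_round hs d UNIV" "finite G" "Tk k t hs T" "R \<in> objs D - T" "Mk t hs T < B_bound t hs R"
    and none: "candidates k t hs = {}"
    and unseen: "\<And>R. R \<in> objs D \<Longrightarrow> R \<notin> seen hs \<Longrightarrow> Mk t hs T < B_bound t hs R \<Longrightarrow> R \<in> G"
  shows "N \<le> Suc d + card G + randoms hs"
proof -
  note level = in_round_level[OF assms(1)]
  have f: "faithful D hs" and clean: "\<And>R i r. RandomRes R i r \<in> set hs \<Longrightarrow> \<not> incomplete hs R"
    using assms(1) by (auto simp: in_round_def)
  have threshold: "t (\<chi> i. bottom hs i) \<le> B_bound t hs R'" if "incomplete hs R'" for R'
    using threshold_le_B[OF level(1)] clean that by blast
  have no_candidate: "\<not> incomplete hs R'" if "R' \<in> seen hs" "Mk t hs T < B_bound t hs R'" for R'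
    using that none assms(3) by (auto simp: candidates_def viable_def)
  \<comment> \<open>For a complete object outside \<open>T\<close> the B value equals the W value,
    which is at most \<open>Mk\<close>.\<close>
  have "incomplete hs R"
    using W_le_Mk[OF assms(3) k] W_complete[OF f] B_complete[OF f] complete_seen assms(4,5)
    by (metis DiffD2 leD)
  then have "R \<notin> seen hs" using no_candidate assms(5) by blast
  \<comment> \<open>\<open>R\<close> is unseen, so the threshold itself exceeds \<open>Mk\<close>.
    Incomplete objects have at least this B value, so a seen one would be a candidate.\<close>
  then have Mk: "Mk t hs T < t (\<chi> i. bottom hs i)" using B_unseen assms(5) by metis
  \<comment> \<open>One arbitrary list suffices: a complete object is known in it by sorted access,
    unless CA requested that field at random.\<close>
  obtain i :: 'm where True by simp
  have "objs D \<subseteq> fst ` set (take (Suc d) (D i)) \<union> (G \<union> random_objs hs)"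
  proof
    fix Q assume Q: "Q \<in> objs D"
    show "Q \<in> fst ` set (take (Suc d) (D i)) \<union> (G \<union> random_objs hs)"
    proof (cases "Q \<in> seen hs")
      case False
      then show ?thesis using unseen[OF Q] B_unseen Mk by fastforce
    next
      case True
      then have "\<not> incomplete hs Q" using no_candidate threshold Mk by fastforce
      then have "field hs Q i = Some (grade D Q i)" by (rule complete_field[OF f])
      then have "(Q, grade D Q i) \<in> set (take (Suc d) (D i)) \<or> (\<exists>r. RandomRes Q i r \<in> set hs)"
        using field_faithful[OF f distinct_objs] level(2) by metis
      then show ?thesis by force
    qed
  qed
  then have "N \<le> card (fst ` set (take (Suc d) (D i)) \<union> (G \<union> random_objs hs))"
    using card_random_objs(1) assms(2) by (intro card_mono) auto
  also have "\<dots> \<le> card (fst ` set (take (Suc d) (D i))) + (card G + card (random_objs hs))"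
    by (meson add_le_cancel_left card_Un_le order_trans)
  also have "card (fst ` set (take (Suc d) (D i))) \<le> Suc d"
    by (metis card_image_le card_length length_take List.finite_set min.cobounded2 order_trans)
  finally show ?thesis using card_random_objs(2)[of hs] by linarith
qed

text \<open>Depths from \<open>h * j0\<close> on lie beyond all sorted accesses of \<open>A\<close>,
  so \<open>not_overlooked\<close> confines the picks to \<open>G\<close>. \<open>charged\<close>
  can then fail only where CA goes on without a pick; there \<open>few_objects_left\<close> bounds
  \<open>N\<close>, with depth at most \<open>h * (j0 + card G)\<close> and at most
  \<open>CARD('m)\<close> times as many random accesses.\<close>

lemma charged_or_few_objects:
  assumes A: "finds_top_k k t {D. is_database k D \<and> distinctness D} A"
    and Y: "outputs A D Y" "is_top_k k t D Y"
    and j0: "1 \<le> j0" "2 \<le> h * j0" "k \<le> h * j0"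
      "\<And>i. sorted_count (final_history A D) i < h * j0"
  defines "G \<equiv> Y \<union> random_objs (final_history A D)"
  shows "charged G j0 \<or> N \<le> (CARD('m) + 1) * (h * (j0 + card G)) + card G"
proof (rule disjCI)
  assume many: "\<not> N \<le> (CARD('m) + 1) * (h * (j0 + card G)) + card G"
  have fin: "finite G"
    using Y(2) finite_objs card_random_objs(1)[of "final_history A D"] finite_subset
    unfolding G_def is_top_k_def by blast
  show "charged G j0"
    unfolding charged_def
  proof (intro conjI allI impI fin j0(1))
    fix hs d
    assume r: "in_round hs d UNIV" "randoms hs \<le> CARD('m) * (d div h)" "h dvd Suc d"
      and j: "j0 \<le> Suc d div h" "Suc d div h \<le> j0 + card G"
    note level = in_round_level[OF r(1)]
    have f: "faithful D hs" and clean: "\<And>R i r. RandomRes R i r \<in> set hs \<Longrightarrow> \<not> incomplete hs R"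
      using r(1) by (auto simp: in_round_def)
    have Suc: "Suc d = h * (Suc d div h)" using r(3) by simp
    have lower: "h * j0 \<le> Suc d" using j(1) by (subst Suc) (rule mult_le_mono2)
    have upper: "Suc d \<le> h * (j0 + card G)" using j(2) by (subst Suc) (rule mult_le_mono2)
    \<comment> \<open>Excludes the clause for fewer than \<open>k\<close> seen objects in
      \<open>viable\<close> and \<open>continues\<close>, so that a witness \<open>T\<close> is
      available.\<close>
    have "k \<le> card (seen hs)" using depth_le_seen[OF level(1,2)] lower j0(3) by linarith
    have overlooked: False
      if "R \<in> objs D" "R \<notin> G" "incomplete hs R" "Tk k t hs T" "Mk t hs T < B_bound t hs R"
        "\<And>R'. R' \<in> candidates k t hs \<Longrightarrow> B_bound t hs R' \<le> B_bound t hs R" for R T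
    proof (rule not_overlooked[OF A Y k level(1,2) _ clean _ _ that(1) _ that(3-6)])
      show "2 \<le> Suc d" using lower j0(2) by linarith
      show "sorted_count (final_history A D) i < Suc d" for i using lower j0(4)[of i] by linarith
      show "RandomRes R i r \<notin> set (final_history A D)" "R \<notin> Y" for i r
        using that(2) unfolding G_def by blast+
    qed
    have targets: "targets h k t hs =
        {R \<in> candidates k t hs. \<forall>R'\<in>candidates k t hs. B_bound t hs R' \<le> B_bound t hs R}"
      using level(3,4) r(3) by (auto simp: targets_def)
    show "targets h k t hs \<subseteq> G"
    proof
      fix R assume "R \<in> targets h k t hs"
      then have R: "R \<in> candidates k t hs"
          "\<And>R'. R' \<in> candidates k t hs \<Longrightarrow> B_bound t hs R' \<le> B_bound t hs R"
        using targets by auto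
      then obtain T where "Tk k t hs T" "Mk t hs T < B_bound t hs R"
        using \<open>k \<le> card (seen hs)\<close> by (auto simp: candidates_def viable_def)
      then show "R \<in> G" using overlooked[of R T] R seen_objs[OF f] by (auto simp: candidates_def)
    qed
    show "\<not> (targets h k t hs = {} \<and> continues hs)"
    proof
      assume stuck: "targets h k t hs = {} \<and> continues hs"
      have "finite (candidates k t hs)" using finite_seen[of hs] by (simp add: candidates_def)
      then have none: "candidates k t hs = {}"
        using ex_arg_max_real[of "candidates k t hs" "B_bound t hs"] stuck targets by blast
      obtain T R where T: "Tk k t hs T" "R \<in> objs D - T" "Mk t hs T < B_bound t hs R"
        using stuck \<open>k \<le> card (seen hs)\<close> by auto
      have "N \<le> Suc d + card G + randoms hs"
      proof (rule few_objects_left[OF r(1) fin T none])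
        fix R assume "R \<in> objs D" "R \<notin> seen hs" "Mk t hs T < B_bound t hs R"
        \<comment> \<open>An unseen object is incomplete, and without candidates the maximality
          premise is vacuous.\<close>
        then show "R \<in> G" using overlooked[of R T] T(1) none complete_seen by fastforce
      qed
      moreover have "randoms hs \<le> CARD('m) * Suc d"
        using r(2) div_le_dividend[of d h] by (meson le_SucI mult_le_mono2 order_trans)
      ultimately have "N \<le> (CARD('m) + 1) * Suc d + card G" by simp
      moreover have "(CARD('m) + 1) * Suc d \<le> (CARD('m) + 1) * (h * (j0 + card G))"
        by (rule mult_le_mono2[OF upper])
      ultimately show False using many by linarith
    qed
  qed
qed

text \<open>In the factor of \<open>h\<close>, \<open>k\<close> plus the number of random accesses
  of \<open>A\<close> bounds \<open>card G\<close>, and 2 pays for rounding \<open>j0\<close> and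
  the final depth. The factor \<open>CARD('m) + 1\<close> and the last two summands come from the
  case of few objects, where \<open>d \<le> N\<close> is used.\<close>

lemma final_depth_bound:
  assumes A: "finds_top_k k t {D. is_database k D \<and> distinctness D} A"
  obtains d where "length (filter is_sorted (final_history CA D)) = CARD('m) * d"
    "randoms (final_history CA D) \<le> CARD('m) * (d div h)"
    "d \<le> (CARD('m) + 1) * (length (filter is_sorted (final_history A D)) + 2 + k +
        h * (k + 2 + randoms (final_history A D))) + k + randoms (final_history A D)"
proof -
  obtain Y where Y: "outputs A D Y" "is_top_k k t D Y"
    using A db dist by (auto simp: finds_top_k_def)
  define s where "s = length (filter is_sorted (final_history A D))"
  define r where "r = randoms (final_history A D)"
  define G where "G = Y \<union> random_objs (final_history A D)"
  \<comment> \<open>The least \<open>j0\<close> with \<open>h * j0\<close> strictly above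
    \<open>s + 2 + k\<close>; it meets all lower bounds on \<open>h * j0\<close> at once.\<close>
  define j0 where "j0 = (s + 2 + k) div h + 1"
  have d0: "s + 2 + k < h * j0"
    using h dividend_less_times_div[of h "s + 2 + k"] by (simp add: j0_def)
  have "sorted_count (final_history A D) i \<le> s" for i
    unfolding s_def length_filter_sorted by (rule member_le_sum) auto
  then have "sorted_count (final_history A D) i < h * j0" for i
    using d0 by (metis add_lessD1 le_less_trans)
  moreover have "1 \<le> j0" by (simp add: j0_def)
  moreover have "2 \<le> h * j0" "k \<le> h * j0" using d0 by linarith+
  ultimately have "1 \<le> j0" "2 \<le> h * j0" "k \<le> h * j0"
      "\<And>i. sorted_count (final_history A D) i < h * j0" by blast+
  note ch = charged_or_few_objects[OF A Y this, folded G_def]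
  have "card G \<le> k + r"
    using card_Un_le[of Y "random_objs (final_history A D)"] Y(2)
      card_random_objs(2)[of "final_history A D"]
    unfolding G_def r_def is_top_k_def by linarith
  have "h * j0 \<le> s + 2 + k + h" by (simp add: j0_def)
  then have "h * (j0 + card G + 1) \<le> s + 2 + k + h + (h * (k + r) + h)"
    using mult_le_mono2[OF \<open>card G \<le> k + r\<close>, of h] by (simp add: add_mult_distrib2)
  also have "\<dots> = s + 2 + k + h * (k + 2 + r)" by (simp add: add_mult_distrib2)
  finally have bound: "h * (j0 + card G + 1) \<le> s + 2 + k + h * (k + 2 + r)" .
  from ch show thesis
  proof
    assume "charged G j0"
    then obtain d where d: "length (filter is_sorted (final_history CA D)) = CARD('m) * d"
      "randoms (final_history CA D) \<le> CARD('m) * (d div h)" "d div h \<le> j0 + card G"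
      using final_history_bound by metis
    have "d \<le> h * (d div h) + h" using h dividend_less_times_div[of h d] by simp
    also have "\<dots> \<le> h * (j0 + card G + 1)" using mult_le_mono2[OF d(3), of h] by simp
    also note bound
    finally have "d \<le> (CARD('m) + 1) * (s + 2 + k + h * (k + 2 + r)) + k + r" by simp
    then show thesis using that d(1,2) by (simp only: s_def r_def)
  next
    assume N: "N \<le> (CARD('m) + 1) * (h * (j0 + card G)) + card G"
    obtain d where d: "length (filter is_sorted (final_history CA D)) = CARD('m) * d"
      "randoms (final_history CA D) \<le> CARD('m) * (d div h)" "d \<le> N"
      using final_history_bound[OF trivially_charged] by metis
    have "h * (j0 + card G) \<le> s + 2 + k + h * (k + 2 + r)" using bound by simp
    then have "(CARD('m) + 1) * (h * (j0 + card G)) \<le> (CARD('m) + 1) * (s + 2 + k + h * (k + 2 + r))"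
      by (rule mult_le_mono2)
    then have "d \<le> (CARD('m) + 1) * (s + 2 + k + h * (k + 2 + r)) + k + r"
      using N d(3) \<open>card G \<le> k + r\<close> by linarith
    then show thesis using that d(1,2) by (simp only: s_def r_def)
  qed
qed

end

section \<open>Comparison of the costs\<close>

theorem theorem8p9:
  fixes t :: "real ^ 'm::finite \<Rightarrow> real" and k :: nat
    and DD :: "('a, 'm) database set"
    and AA :: "('a, 'm) algorithm set"
  assumes "k \<ge> 1"
    and "aggregation_function t"
    and "strictly_monotone_each t"
    and "DD = {D. is_database k D \<and> distinctness D}"
    and "AA = {A. finds_top_k k t DD A}"
  shows "\<exists>c. \<forall>cS cR. 0 < cS \<and> cS \<le> cR \<longrightarrow>
           (\<forall>CA. is_CA cS cR k t CA \<longrightarrow> instance_optimal cS cR AA DD c CA)"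
proof -
  define m where "m = real CARD('m)"
  have m: "1 \<le> m" by (simp add: m_def)
  \<comment> \<open>\<open>m + 2\<close> comes from the depth bound, \<open>m\<close> from the
    number of lists, and 3 = 1 + 2 because the random accesses of CA cost at most twice as much as
    its sorted ones.\<close>
  have "instance_optimal cS cR AA DD (3 * m * (m + 2)) CA"
    if c: "0 < cS" "cS \<le> cR" and CA: "is_CA cS cR k t CA" for cS cR and CA :: "('a, 'm) algorithm"
  proof -
    define h where "h = nat \<lfloor>cR / cS\<rfloor>"
    have "1 \<le> cR / cS" using c by simp
    then have floor: "1 \<le> \<lfloor>cR / cS\<rfloor>" by (simp only: one_le_floor)
    then have h: "1 \<le> h" unfolding h_def by linarith
    have "real h = of_int \<lfloor>cR / cS\<rfloor>" using floor by (simp add: h_def)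
    then have "real h \<le> cR / cS" "cR / cS < real h + 1" by linarith+
    then have h_le: "h * cS \<le> cR" and less_h: "cR < (real h + 1) * cS"
      using c(1) by (simp_all add: field_simps)
    \<comment> \<open>\<open>h\<close> rounds \<open>cR / cS\<close> down; as \<open>h\<close> is at
      least 1, this loses at most a factor 2.\<close>
    have "cR \<le> 2 * (h * cS)"
    proof -
      have "1 * cS \<le> h * cS" using h c(1) by (intro mult_right_mono) auto
      then show ?thesis using less_h by (simp add: algebra_simps)
    qed
    note h_bounds = h_le this
    have run: "CA_run D k t h CA" if "D \<in> DD" for D
      using that assms(1,3,4) CA h by unfold_locales (auto simp: is_CA_def h_def)
    have "CA \<in> AA"
      using CA_run.CA_correct[OF run] by (auto simp: assms(5) finds_top_k_def)
    moreover have "cost cS cR CA D \<le> 3 * m * (m + 2) * cost cS cR A D +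
        3 * m * ((m + 1) * ((2 + k) * cS + (k + 2) * cR) + k * cS)"
      if A: "A \<in> AA" and D: "D \<in> DD" for A D
    proof -
      interpret CA_run D k t h CA by (rule run[OF D])
      define s where "s = real (length (filter is_sorted (final_history A D)))"
      define r where "r = real (randoms (final_history A D))"
      have "finds_top_k k t {D. is_database k D \<and> distinctness D} A"
        using A assms(4,5) by simp
      from final_depth_bound[OF this] obtain d where
        d: "length (filter is_sorted (final_history CA D)) = CARD('m) * d"
        "randoms (final_history CA D) \<le> CARD('m) * (d div h)"
        "d \<le> (CARD('m) + 1) * (length (filter is_sorted (final_history A D)) + 2 + k +
          h * (k + 2 + randoms (final_history A D))) + k + randoms (final_history A D)" .
      have "real d \<le> (m + 1) * (s + 2 + k + h * (k + 2 + r)) + k + r"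
        using of_nat_mono[OF d(3), where ?'a = real] by (simp add: m_def s_def r_def algebra_simps)
      then have "d * cS \<le> ((m + 1) * (s + 2 + k + h * (k + 2 + r)) + k + r) * cS"
        using c(1) by (intro mult_right_mono) auto
      also have "\<dots> = (m + 1) * (s * cS + (2 + k) * cS + (k + 2 + r) * (h * cS)) + k * cS + r * cS"
        by (simp add: algebra_simps)
      \<comment> \<open>\<open>h\<close> sorted accesses cost no more than one random access, and
        \<open>cS \<le> cR\<close> handles the last summand. This removes \<open>h\<close> from the
        bound.\<close>
      also have "\<dots> \<le> (m + 1) * (s * cS + (2 + k) * cS + (k + 2 + r) * cR) + k * cS + r * cR"
        using h_bounds(1) c m
        by (intro add_mono mult_left_mono order_refl) (auto simp: r_def)
      \<comment> \<open>\<open>r * cR\<close> occurs \<open>m + 1\<close> times in the product and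
        once more at the end. Terms without \<open>s\<close> and \<open>r\<close> go into the
        additive constant, which may depend on the costs.\<close>
      also have "\<dots> \<le> (m + 2) * (s * cS + r * cR) + ((m + 1) * ((2 + k) * cS + (k + 2) * cR) + k * cS)"
        using c(1) by (simp add: algebra_simps s_def)
      finally have depth: "d * cS \<le> (m + 2) * cost cS cR A D +
          ((m + 1) * ((2 + k) * cS + (k + 2) * cR) + k * cS)"
        by (simp add: cost_def s_def r_def)
      have "real (randoms (final_history CA D)) \<le> m * real (d div h)"
        using of_nat_mono[OF d(2), where ?'a = real] by (simp add: m_def)
      then have "real (randoms (final_history CA D)) * cR \<le> m * real (d div h) * cR"
        using c by (intro mult_right_mono) auto
      \<comment> \<open>Each block of \<open>h\<close> depths accounts for at most \<open>m\<close>
        random accesses, each worth at most \<open>2 * h\<close> sorted ones.\<close>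
      also have "\<dots> \<le> m * real (d div h) * (2 * (h * cS))"
        using h_bounds(2) m by (intro mult_left_mono) auto
      also have "\<dots> = 2 * m * (real (h * (d div h)) * cS)" by simp
      also have "\<dots> \<le> 2 * m * (d * cS)"
      proof -
        have "real (h * (d div h)) \<le> real d" by (simp only: of_nat_le_iff) simp
        then show ?thesis using c(1) m by (intro mult_left_mono mult_right_mono) auto
      qed
      finally have "cost cS cR CA D \<le> 3 * m * (d * cS)"
        unfolding cost_def d(1) by (simp add: m_def mult_ac)
      also have "\<dots> \<le> 3 * m * ((m + 2) * cost cS cR A D +
          ((m + 1) * ((2 + k) * cS + (k + 2) * cR) + k * cS))"
        using depth m by (intro mult_left_mono) auto
      finally show ?thesis by (simp add: algebra_simps)
    qed
    ultimately show ?thesis unfolding instance_optimal_def by blast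
  qed
  then show ?thesis by blast
qed

end
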